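(* Let $T$ be a densely defined closed operator in $H$ which is absolutely minimum attaining, unbounded, and such that $T^{-1}\in\mathcal B(H)$. Then $T$ has a non-trivial hyperinvariant subspace, i.e. there is a closed subspace $M$ of $H$ with $\{0\}\neq M\neq H$ which is hyperinvariant for $T$.
   Context: $H$ is an infinite dimensional complex Hilbert space and $\mathcal B(H)$ is the space of bounded everywhere defined operators on $H$. For a densely defined closed operator $T$ with domain $D(T)\subseteq H$ and a closed subspace $M$ of $H$ with $D(T)\cap M\neq\{0\}$, put $m(T|_M)=\inf\{\|Tx\|: x\in D(T)\cap M,\ \|x\|=1\}$. $T$ is called absolutely minimum attaining if for every closed subspace $M$ of $H$ with $D(T)\cap M\ne\{0\}$ there is $x_0\in D(T)\cap M$ with $\|x_0\|=1$ and $\|Tx_0\|=m(T|_M)$. A closed subspace $M$ of $H$ is hyperinvariant for $T$ if $S(M)\subseteq M$ for every $S\in\mathcal B(H)$ with $ST\subseteq TS$, meaning that for all $x\in D(T)$ one has $Sx\in D(T)$ and $STx=TSx$. *)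

theory Defs
  imports "HOL-Analysis.Analysis"
begin

section \<open>Complex Hilbert spaces\<close>

text \<open>
  A complex inner product space is given over its underlying real inner product space, whose inner
  product is the real part of the complex one. In particular
  \<^term>\<open>norm x = sqrt (Re (cinner x x))\<close> for all \<open>x\<close>.
  The form is linear in the first argument.
\<close>

class complex_inner = real_inner +
  fixes scaleC :: "complex \<Rightarrow> 'a \<Rightarrow> 'a"  (infixr \<open>*\<^sub>C\<close> 75)
    and cinner :: "'a \<Rightarrow> 'a \<Rightarrow> complex"
  assumes scaleC_add_right: "a *\<^sub>C (x + y) = a *\<^sub>C x + a *\<^sub>C y"
    and scaleC_add_left: "(a + b) *\<^sub>C x = a *\<^sub>C x + b *\<^sub>C x"
    and scaleC_scaleC: "a *\<^sub>C b *\<^sub>C x = (a * b) *\<^sub>C x"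
    and scaleR_scaleC: "r *\<^sub>R x = complex_of_real r *\<^sub>C x"
    and cinner_add_left: "cinner (x + y) z = cinner x z + cinner y z"
    and cinner_scaleC_left: "cinner (a *\<^sub>C x) y = a * cinner x y"
    and cinner_commute: "cinner x y = cnj (cinner y x)"
    and inner_cinner: "inner x y = Re (cinner x y)"

class chilbert_space = complex_inner + complete_space

global_interpretation complex_vector:
  vector_space "scaleC :: complex \<Rightarrow> 'a \<Rightarrow> 'a :: complex_inner"
proof
  show "1 *\<^sub>C x = x" for x :: 'a
    using scaleR_scaleC[of 1 x] by simp
qed (simp_all add: scaleC_add_right scaleC_add_left scaleC_scaleC)

definition closed_csubspace :: "'a::complex_inner set \<Rightarrow> bool" where
  "closed_csubspace M \<longleftrightarrow> complex_vector.subspace M \<and> closed M"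

definition bounded_clinear :: "('a::complex_inner \<Rightarrow> 'a) \<Rightarrow> bool" where
  "bounded_clinear S \<longleftrightarrow> bounded_linear S \<and> (\<forall>a x. S (a *\<^sub>C x) = a *\<^sub>C S x)"

section \<open>Operators with a domain\<close>

text \<open>
  An operator in the space is a pair of a domain \<open>D\<close> and a function \<open>T\<close>, of which only
  the values on \<open>D\<close> are relevant.
\<close>

definition operator_on :: "'a::complex_inner set \<Rightarrow> ('a \<Rightarrow> 'a) \<Rightarrow> bool" where
  "operator_on D T \<longleftrightarrow> complex_vector.subspace D \<and>
     (\<forall>x\<in>D. \<forall>y\<in>D. T (x + y) = T x + T y) \<and> (\<forall>a. \<forall>x\<in>D. T (a *\<^sub>C x) = a *\<^sub>C T x)"

definition densely_defined :: "'a::complex_inner set \<Rightarrow> bool" where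
  "densely_defined D \<longleftrightarrow> closure D = UNIV"

definition closed_operator :: "'a::complex_inner set \<Rightarrow> ('a \<Rightarrow> 'a) \<Rightarrow> bool" where
  "closed_operator D T \<longleftrightarrow> operator_on D T \<and> closed ((\<lambda>x. (x, T x)) ` D)"

definition unbounded_operator :: "'a::complex_inner set \<Rightarrow> ('a \<Rightarrow> 'a) \<Rightarrow> bool" where
  "unbounded_operator D T \<longleftrightarrow> \<not> (\<exists>K. \<forall>x\<in>D. norm (T x) \<le> K * norm x)"

definition has_bounded_inverse :: "'a::complex_inner set \<Rightarrow> ('a \<Rightarrow> 'a) \<Rightarrow> bool" where
  "has_bounded_inverse D T \<longleftrightarrow> bij_betw T D UNIV \<and> bounded_clinear (inv_into D T)"

definition min_modulus_on :: "'a::complex_inner set \<Rightarrow> ('a \<Rightarrow> 'a) \<Rightarrow> 'a set \<Rightarrow> real" where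
  "min_modulus_on D T M = Inf {norm (T x) | x. x \<in> D \<inter> M \<and> norm x = 1}"

definition absolutely_minimum_attaining :: "'a::complex_inner set \<Rightarrow> ('a \<Rightarrow> 'a) \<Rightarrow> bool" where
  "absolutely_minimum_attaining D T \<longleftrightarrow>
     (\<forall>M. closed_csubspace M \<and> D \<inter> M \<noteq> {0} \<longrightarrow>
        (\<exists>x0 \<in> D \<inter> M. norm x0 = 1 \<and> norm (T x0) = min_modulus_on D T M))"

text \<open>The inclusion \<open>S T \<subseteq> T S\<close> of operators.\<close>

definition commutes_with :: "('a::complex_inner \<Rightarrow> 'a) \<Rightarrow> 'a set \<Rightarrow> ('a \<Rightarrow> 'a) \<Rightarrow> bool" where
  "commutes_with S D T \<longleftrightarrow> (\<forall>x\<in>D. S x \<in> D \<and> S (T x) = T (S x))"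

definition hyperinvariant :: "'a::complex_inner set \<Rightarrow> ('a \<Rightarrow> 'a) \<Rightarrow> 'a set \<Rightarrow> bool" where
  "hyperinvariant D T M \<longleftrightarrow> closed_csubspace M \<and>
     (\<forall>S. bounded_clinear S \<and> commutes_with S D T \<longrightarrow> S ` M \<subseteq> M)"

end

theory Submission
  imports Defs "HOL-Complex_Analysis.Cauchy_Integral_Formula"
begin

text \<open>
  Let \<open>A\<close> be the bounded inverse of \<open>T\<close>. Attaining the minimum of \<open>T\<close> on \<open>M\<close> means that \<open>A\<close> attains its
  norm on \<open>A -` M\<close>. If \<open>M\<close> is the orthogonal complement of the images under \<open>A\<close> of eigenvectors of
  \<open>A* A\<close>, then \<open>A -` M\<close> is the orthogonal complement of these eigenvectors, and a maximizer is again an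
  eigenvector. Hence the eigenvectors of \<open>A* A\<close> are total, and as \<open>T\<close> is unbounded there are infinitely
  many orthonormal ones with arbitrarily small eigenvalues. If there were also infinitely many
  orthonormal eigenvectors with eigenvalues above some \<open>\<beta> > 0\<close>, pairing the two kinds would give unit
  vectors \<open>q n\<close>, spanning a subspace \<open>A -` M\<close>, for which the \<open>A (q n)\<close> are orthogonal with strictly
  increasing norms, so that the norm would not be attained there. So \<open>A\<close> is compact, and Lomonosov's
  theorem yields a subspace invariant under all operators that commute with \<open>A\<close>. A nonzero eigenvalue of
  \<open>A\<close> provides an eigenspace; otherwise the resolvent is entire, so the powers of \<open>A\<close> decay faster than
  any geometric sequence, and Hilden's argument applies.
\<close>

section \<open>Complex inner product spaces\<close>

lemma cinner_add_right: "cinner x (y + z) = cinner x y + cinner x z"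
  by (metis cinner_commute cinner_add_left complex_cnj_add)

lemma cinner_scaleC_right: "cinner x (a *\<^sub>C y) = cnj a * cinner x y"
  by (metis cinner_commute cinner_scaleC_left complex_cnj_mult)

lemma cinner_self: "cinner x x = complex_of_real ((norm x)\<^sup>2)"
proof -
  have "Im (cinner x x) = 0"
    using arg_cong[OF cinner_commute[of x x], of Im] by simp
  then show ?thesis
    by (simp add: complex_eq_iff power2_norm_eq_inner inner_cinner)
qed

lemma norm_scaleC: "norm (a *\<^sub>C x) = cmod a * norm x"
proof -
  have "complex_of_real ((norm (a *\<^sub>C x))\<^sup>2) = a * cnj a * complex_of_real ((norm x)\<^sup>2)"
    unfolding cinner_self[symmetric] by (simp add: cinner_scaleC_left cinner_scaleC_right)
  also have "\<dots> = complex_of_real ((cmod a * norm x)\<^sup>2)"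
    by (simp add: complex_norm_square[symmetric] power_mult_distrib)
  finally have "(norm (a *\<^sub>C x))\<^sup>2 = (cmod a * norm x)\<^sup>2"
    using of_real_eq_iff by blast
  then show ?thesis
    by (simp add: power2_eq_iff_nonneg)
qed

text \<open>Multiplying \<open>x\<close> by a unimodular number makes the inner product real and
  nonnegative, which reduces the claim to the real Cauchy-Schwarz inequality.\<close>

lemma norm_cinner_le: "cmod (cinner x y) \<le> norm x * norm y"
proof (cases "cinner x y = 0")
  case False
  define a where "a = cnj (sgn (cinner x y))"
  have "cmod (cinner x y) = Re (a * cinner x y)"
  proof -
    have "a * cinner x y = cinner x y * cnj (cinner x y) / of_real (cmod (cinner x y))"
      by (simp add: a_def sgn_eq mult.commute)
    also have "\<dots> = of_real (cmod (cinner x y))"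
      using False unfolding complex_norm_square[symmetric] by (simp add: power2_eq_square)
    finally show ?thesis by simp
  qed
  also have "\<dots> = inner (a *\<^sub>C x) y"
    by (simp add: inner_cinner cinner_scaleC_left)
  also have "\<dots> \<le> norm (a *\<^sub>C x) * norm y"
    by (rule norm_cauchy_schwarz)
  finally show ?thesis
    using False by (simp add: norm_scaleC a_def norm_sgn)
qed simp

interpretation cinner: bounded_bilinear "cinner :: 'a::complex_inner \<Rightarrow> 'a \<Rightarrow> complex"
  by (rule bounded_bilinear.intro)
    (auto simp: cinner_add_left cinner_add_right scaleR_scaleC cinner_scaleC_left
      cinner_scaleC_right scaleR_conv_of_real norm_cinner_le intro!: exI[of _ 1])

interpretation scaleC: bounded_bilinear "scaleC :: complex \<Rightarrow> 'a::complex_inner \<Rightarrow> 'a"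
  by (rule bounded_bilinear.intro)
    (auto simp: scaleC_add_left scaleC_add_right scaleR_scaleC scaleC_scaleC norm_scaleC
      scaleR_conv_of_real mult.commute intro!: exI[of _ 1])

lemma norm_add_square:
  fixes x :: "'a::complex_inner"
  shows "(norm (x + y))\<^sup>2 = (norm x)\<^sup>2 + 2 * Re (cinner x y) + (norm y)\<^sup>2"
  by (simp add: power2_norm_eq_inner inner_cinner[symmetric] inner_add_left inner_add_right
      inner_commute)

text \<open>A first-order variation without derivatives: along small multiples of
  \<open>cnj c\<close> the linear term would dominate the quadratic one. It yields orthogonality at
  closest points and the eigenvector equation at maximizers.\<close>

lemma linear_le_quadratic_zero:
  fixes c :: complex
  assumes "\<And>t. 2 * Re (t * c) \<le> (cmod t)\<^sup>2 * b"
  shows "c = 0"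
proof (rule ccontr)
  assume "c \<noteq> 0"
  define s where "s = 1 / (\<bar>b\<bar> + 1)"
  have s: "s > 0" "s * b < 1"
    by (auto simp: s_def field_simps)
  have "2 * (s * (cmod c)\<^sup>2) = 2 * Re (of_real s * cnj c * c)"
    unfolding mult.assoc mult.commute[of "cnj c"] complex_norm_square[symmetric] by simp
  also have "\<dots> \<le> (cmod (of_real s * cnj c))\<^sup>2 * b"
    by (rule assms)
  also have "\<dots> = (s * b) * (s * (cmod c)\<^sup>2)"
    by (simp add: norm_mult power_mult_distrib power2_eq_square)
  also have "\<dots> \<le> 1 * (s * (cmod c)\<^sup>2)"
    using s by (intro mult_right_mono) auto
  finally show False
    using s \<open>c \<noteq> 0\<close> by (simp add: mult_le_0_iff)
qed

section \<open>Orthogonal complements and the projection theorem\<close>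

definition orth :: "'a::complex_inner set \<Rightarrow> 'a set" where
  "orth P = {x. \<forall>p\<in>P. cinner x p = 0}"

lemma orthD: "x \<in> orth P \<Longrightarrow> p \<in> P \<Longrightarrow> cinner x p = 0"
  by (simp add: orth_def)

lemma closed_csubspace_orth: "closed_csubspace (orth P)"
proof -
  have "closed (orth P)"
    unfolding orth_def Ball_def
    by (intro closed_Collect_all closed_Collect_imp open_Collect_const closed_Collect_eq
        continuous_intros cinner.continuous_on)
  then show ?thesis
    by (simp add: closed_csubspace_def complex_vector.subspace_def orth_def cinner_add_left
        cinner_scaleC_left cinner.zero_left)
qed

lemma csubspace_convex: "complex_vector.subspace V \<Longrightarrow> convex V"
  unfolding convex_def complex_vector.subspace_def scaleR_scaleC by blast

text \<open>Moving \<open>v\<close> by \<open>t *\<^sub>C w\<close> inside \<open>V\<close> cannot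
  decrease the distance to \<open>x\<close>, so the term linear in \<open>t\<close> must
  vanish.\<close>

lemma closest_point_orthogonal:
  fixes x :: "'a::complex_inner"
  assumes "complex_vector.subspace V" "v \<in> V"
    and min: "\<And>w. w \<in> V \<Longrightarrow> norm (x - v) \<le> norm (x - w)"
  shows "x - v \<in> orth V"
  unfolding orth_def
proof safe
  fix w assume "w \<in> V"
  have "2 * Re (t * cinner w (x - v)) \<le> (cmod t)\<^sup>2 * (norm w)\<^sup>2" for t
  proof -
    have "v + t *\<^sub>C w \<in> V"
      using assms \<open>w \<in> V\<close> complex_vector.subspace_add complex_vector.subspace_scale by blast
    then have "norm (x - v) \<le> norm ((x - v) + (- t) *\<^sub>C w)"
      using min[of "v + t *\<^sub>C w"] by (simp add: algebra_simps scaleC.minus_left)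
    then have "(norm (x - v))\<^sup>2 \<le> (norm ((x - v) + (- t) *\<^sub>C w))\<^sup>2"
      by (simp add: power_mono)
    then have "2 * Re (cnj t * cinner (x - v) w) \<le> (cmod t)\<^sup>2 * (norm w)\<^sup>2"
      unfolding norm_add_square
      by (simp add: cinner_scaleC_right norm_scaleC power_mult_distrib scaleC.minus_left
          cinner.minus_right)
    also have "cnj t * cinner (x - v) w = cnj (t * cinner w (x - v))"
      using cinner_commute[of "x - v" w] by simp
    finally show ?thesis by simp
  qed
  then have "cinner w (x - v) = 0"
    by (rule linear_le_quadratic_zero)
  then show "cinner (x - v) w = 0"
    by (metis cinner_commute complex_cnj_zero)
qed

text \<open>Midpoints of a minimizing sequence stay in \<open>V\<close>, so the parallelogram law
  makes the sequence Cauchy; its limit realizes the distance.\<close>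

theorem closed_csubspace_projection:
  fixes x :: "'a::chilbert_space"
  assumes "closed_csubspace V"
  obtains v where "v \<in> V" "x - v \<in> orth V"
proof -
  have V: "complex_vector.subspace V" "closed V" "V \<noteq> {}"
    using assms complex_vector.subspace_0 by (auto simp: closed_csubspace_def)
  define d where "d = infdist x V"
  have d: "d \<ge> 0" "\<And>w. w \<in> V \<Longrightarrow> d \<le> norm (x - w)"
    using infdist_le[of _ V x] by (auto simp: d_def infdist_nonneg dist_norm)
  have "\<exists>w\<in>V. (norm (x - w))\<^sup>2 < d\<^sup>2 + 1 / real (Suc n)" for n
  proof -
    have "d < sqrt (d\<^sup>2 + 1 / real (Suc n))"
      by (rule real_less_rsqrt) simp
    then obtain w where "w \<in> V" "dist x w < sqrt (d\<^sup>2 + 1 / real (Suc n))"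
      using V(3) infdist_notempty[of V x] unfolding d_def
      by (metis (no_types, lifting) bdd_below_image_dist cINF_less_iff)
    then have "(norm (x - w))\<^sup>2 < (sqrt (d\<^sup>2 + 1 / real (Suc n)))\<^sup>2"
      by (intro power_strict_mono) (auto simp: dist_norm)
    then show ?thesis
      using \<open>w \<in> V\<close> by (auto simp: add_nonneg_nonneg)
  qed
  then obtain w where w: "\<And>n. w n \<in> V" "\<And>n. (norm (x - w n))\<^sup>2 < d\<^sup>2 + 1 / real (Suc n)"
    by metis
  have para: "(norm (w m - w n))\<^sup>2 \<le> 2 / real (Suc m) + 2 / real (Suc n)" for m n
  proof -
    have "(1/2::real) *\<^sub>R w m + (1/2::real) *\<^sub>R w n \<in> V"
      using csubspace_convex[OF V(1)] w(1) by (intro convexD) auto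
    from d(2)[OF this] have "2 * d \<le> norm (2 *\<^sub>R (x - ((1/2::real) *\<^sub>R w m + (1/2::real) *\<^sub>R w n)))"
      by simp
    also have "2 *\<^sub>R (x - ((1/2::real) *\<^sub>R w m + (1/2::real) *\<^sub>R w n)) = (x - w m) + (x - w n)"
      by (simp add: algebra_simps scaleR_2)
    finally have "(2 * d)\<^sup>2 \<le> (norm ((x - w m) + (x - w n)))\<^sup>2"
      using d(1) by (intro power_mono) auto
    moreover have "(norm ((x - w m) + (x - w n)))\<^sup>2 + (norm ((x - w n) + - (x - w m)))\<^sup>2
        = 2 * (norm (x - w m))\<^sup>2 + 2 * (norm (x - w n))\<^sup>2"
      unfolding power2_norm_eq_inner
      by (simp add: inner_add_left inner_add_right inner_diff_left inner_diff_right inner_commute)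
    moreover have "(x - w n) + - (x - w m) = w m - w n" by simp
    ultimately show ?thesis
      using w(2)[of m] w(2)[of n] by (simp add: power_mult_distrib)
  qed
  have "Cauchy w"
  proof (rule metric_CauchyI)
    fix e :: real assume "e > 0"
    then obtain N where N: "1 / real (Suc N) < e\<^sup>2 / 4"
      by (metis nat_approx_posE zero_less_divide_iff zero_less_numeral zero_less_power)
    have "dist (w m) (w n) < e" if "m \<ge> N" "n \<ge> N" for m n
    proof -
      have "1 / real (Suc m) \<le> 1 / real (Suc N)" "1 / real (Suc n) \<le> 1 / real (Suc N)"
        using that by (auto intro!: divide_left_mono)
      then have "(norm (w m - w n))\<^sup>2 < e\<^sup>2"
        using para[of m n] N by simp
      then show ?thesis
        using \<open>e > 0\<close> by (simp add: dist_norm power_less_imp_less_base)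
    qed
    then show "\<exists>N. \<forall>m\<ge>N. \<forall>n\<ge>N. dist (w m) (w n) < e" by blast
  qed
  then obtain v where v: "w \<longlonglongrightarrow> v"
    by (metis Cauchy_convergent_iff convergent_def)
  have "v \<in> V"
    using V(2) w(1) v closed_sequentially by blast
  have "(norm (x - v))\<^sup>2 \<le> d\<^sup>2 + 0"
  proof (rule LIMSEQ_le)
    show "(\<lambda>n. (norm (x - w n))\<^sup>2) \<longlonglongrightarrow> (norm (x - v))\<^sup>2"
      by (intro tendsto_intros v)
    show "(\<lambda>n. d\<^sup>2 + 1 / real (Suc n)) \<longlonglongrightarrow> d\<^sup>2 + 0"
      by (intro tendsto_intros) (use LIMSEQ_inverse_real_of_nat in \<open>simp add: inverse_eq_divide\<close>)
  qed (use w(2) less_imp_le in blast)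
  then have "norm (x - v) \<le> d"
    using d(1) by (simp add: power2_le_iff_abs_le)
  then have "x - v \<in> orth V"
    using d(2) by (intro closest_point_orthogonal V \<open>v \<in> V\<close>) (meson order_trans)
  then show thesis
    using that \<open>v \<in> V\<close> by blast
qed

section \<open>Bounded operators, orthogonal sequences and relative compactness\<close>

lemma bounded_clinearD:
  assumes "bounded_clinear S"
  shows "bounded_linear S" "S (a *\<^sub>C x) = a *\<^sub>C S x" "S (x + y) = S x + S y" "S (x - y) = S x - S y"
    "S 0 = 0"
  using assms by (auto simp: bounded_clinear_def linear_simps)

lemma bounded_clinear_ident: "bounded_clinear (\<lambda>x. x)"
  by (simp add: bounded_clinear_def bounded_linear_ident)

lemma bounded_clinear_compose:
  "bounded_clinear S \<Longrightarrow> bounded_clinear R \<Longrightarrow> bounded_clinear (\<lambda>x. S (R x))"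
  by (simp add: bounded_clinear_def bounded_linear_compose)

lemma bounded_clinear_add:
  "bounded_clinear S \<Longrightarrow> bounded_clinear R \<Longrightarrow> bounded_clinear (\<lambda>x. S x + R x)"
  by (simp add: bounded_clinear_def bounded_linear_add scaleC_add_right)

lemma bounded_clinear_scaleC: "bounded_clinear S \<Longrightarrow> bounded_clinear (\<lambda>x. a *\<^sub>C S x)"
  by (simp add: bounded_clinear_def bounded_linear_compose[OF scaleC.bounded_linear_right]
      scaleC_scaleC mult.commute)

lemma closed_csubspace_closure:
  assumes "complex_vector.subspace W"
  shows "closed_csubspace (closure W)"
  unfolding closed_csubspace_def
proof
  show "complex_vector.subspace (closure W)"
    unfolding complex_vector.subspace_def
  proof (intro conjI ballI allI)
    show "0 \<in> closure W"
      using assms closure_subset complex_vector.subspace_0 by blast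
  next
    fix x y assume "x \<in> closure W" "y \<in> closure W"
    then obtain f g where "\<forall>n. f n \<in> W" "f \<longlonglongrightarrow> x" "\<forall>n. g n \<in> W" "g \<longlonglongrightarrow> y"
      unfolding closure_sequential by blast
    then show "x + y \<in> closure W"
      unfolding closure_sequential
      by (intro exI[of _ "\<lambda>n. f n + g n"])
        (auto intro!: tendsto_add complex_vector.subspace_add[OF assms])
  next
    fix a x assume "x \<in> closure W"
    then obtain f where "\<forall>n. f n \<in> W" "f \<longlonglongrightarrow> x"
      unfolding closure_sequential by blast
    then show "a *\<^sub>C x \<in> closure W"
      unfolding closure_sequential
      by (intro exI[of _ "\<lambda>n. a *\<^sub>C f n"])
        (auto intro!: scaleC.tendsto complex_vector.subspace_scale[OF assms])
  qed
qed simp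

text \<open>Greedy choice. Extension is demanded only for pairwise orthogonal finite families, so
  its failure produces a finite orthogonal family that cannot be enlarged;
  \<open>almost_finite_rank\<close> relies on this.\<close>

lemma orthogonal_sequence:
  fixes P :: "'a::complex_inner \<Rightarrow> bool"
  assumes "\<And>F. finite F \<Longrightarrow> \<forall>f\<in>F. P f \<Longrightarrow> (\<forall>f\<in>F. \<forall>g\<in>F. f \<noteq> g \<longrightarrow> cinner f g = 0) \<Longrightarrow> \<exists>v. P v \<and> v \<in> orth F"
  obtains e :: "nat \<Rightarrow> 'a" where "\<And>n. P (e n)" "\<And>m n. m \<noteq> n \<Longrightarrow> cinner (e m) (e n) = 0"
proof -
  have "\<exists>e. \<forall>n::nat. P (e n) \<and> (\<forall>m<n. cinner (e n) (e m) = 0)"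
  proof (rule dependent_wellorder_choice)
    fix n and e :: "nat \<Rightarrow> 'a"
    assume *: "\<And>m. m < n \<Longrightarrow> P (e m) \<and> (\<forall>k<m. cinner (e m) (e k) = 0)"
    have "cinner (e i) (e j) = 0" if "i < n" "j < n" "i \<noteq> j" for i j
      using that * cinner_commute[of "e i" "e j"] by (cases i j rule: linorder_cases) auto
    then have "\<forall>f\<in>e ` {..<n}. \<forall>g\<in>e ` {..<n}. f \<noteq> g \<longrightarrow> cinner f g = 0"
      by (metis (no_types, lifting) image_iff lessThan_iff)
    moreover have "\<forall>f\<in>e ` {..<n}. P f"
      using * by blast
    ultimately have "\<exists>v. P v \<and> v \<in> orth (e ` {..<n})"
      by (intro assms) auto
    then show "\<exists>v. P v \<and> (\<forall>m<n. cinner v (e m) = 0)"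
      by (auto simp: orth_def)
  qed simp
  then obtain e :: "nat \<Rightarrow> 'a" where e: "\<forall>n. P (e n) \<and> (\<forall>m<n. cinner (e n) (e m) = 0)" ..
  have "cinner (e m) (e n) = 0" if "m \<noteq> n" for m n
    using that e cinner_commute[of "e m" "e n"] by (cases m n rule: linorder_cases) auto
  with e show thesis
    by (intro that[of e]) simp_all
qed

text \<open>An \<open>e / 3\<close>-net of the nearby compact set covers \<open>S\<close> by closed
  balls of radius \<open>2 * e / 3\<close>, and closed balls also cover the closure.\<close>

lemma compact_closure_if_near_compact:
  fixes S :: "'a::complete_space set"
  assumes "\<And>e. e > 0 \<Longrightarrow> \<exists>C. compact C \<and> (\<forall>x\<in>S. \<exists>c\<in>C. dist c x < e)"
  shows "compact (closure S)"
  unfolding compact_eq_totally_bounded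
proof (intro conjI allI impI)
  show "complete (closure S)"
    by (simp add: complete_eq_closed)
  fix e :: real assume "e > 0"
  then obtain C where C: "compact C" "\<And>x. x \<in> S \<Longrightarrow> \<exists>c\<in>C. dist c x < e / 3"
    using assms[of "e/3"] by auto
  obtain k where k: "finite k" "C \<subseteq> (\<Union>x\<in>k. ball x (e / 3))"
    using C(1) \<open>e > 0\<close> unfolding compact_eq_totally_bounded by (metis zero_less_divide_iff zero_less_numeral)
  have "S \<subseteq> (\<Union>x\<in>k. cball x (2 * e / 3))"
  proof
    fix x assume "x \<in> S"
    then obtain c where c: "c \<in> C" "dist c x < e / 3" using C(2) by blast
    then obtain z where "z \<in> k" "dist z c < e / 3" using k(2) by auto
    then show "x \<in> (\<Union>x\<in>k. cball x (2 * e / 3))"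
      using c(2) dist_triangle[of z x c] by (intro UN_I[of z]) auto
  qed
  then have "closure S \<subseteq> (\<Union>x\<in>k. cball x (2 * e / 3))"
    using k(1) by (intro closure_minimal closed_UN) auto
  also have "\<dots> \<subseteq> (\<Union>x\<in>k. ball x e)"
    using \<open>e > 0\<close> by (intro UN_mono) auto
  finally show "\<exists>k. finite k \<and> closure S \<subseteq> (\<Union>x\<in>k. ball x e)"
    using k(1) by blast
qed

lemma compact_bounded_combinations:
  fixes F :: "'a::complex_inner set"
  assumes "finite F"
  shows "compact {\<Sum>f\<in>F. c f *\<^sub>C f | c. \<forall>f. cmod (c f) \<le> r}"
  using assms
proof (induction F rule: finite_induct)
  case empty
  have "{\<Sum>f\<in>{}. c f *\<^sub>C f | c. \<forall>f. cmod (c f) \<le> r} \<subseteq> {0::'a}" by auto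
  then show ?case
    using finite_imp_compact finite_subset by blast
next
  case (insert g F)
  have "{\<Sum>f\<in>insert g F. c f *\<^sub>C f | c. \<forall>f. cmod (c f) \<le> r}
      = {x + y | x y. x \<in> (\<lambda>a. a *\<^sub>C g) ` cball 0 r \<and> y \<in> {\<Sum>f\<in>F. c f *\<^sub>C f | c. \<forall>f. cmod (c f) \<le> r}}"
    (is "?L = ?R")
  proof
    show "?L \<subseteq> ?R"
    proof
      fix z assume "z \<in> ?L"
      then obtain c where "\<forall>f. cmod (c f) \<le> r" "z = (\<Sum>f\<in>insert g F. c f *\<^sub>C f)" by blast
      then have "z = c g *\<^sub>C g + (\<Sum>f\<in>F. c f *\<^sub>C f)" "c g \<in> cball 0 r"
        using insert.hyps by auto
      with \<open>\<forall>f. cmod (c f) \<le> r\<close> show "z \<in> ?R" by blast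
    qed
    show "?R \<subseteq> ?L"
    proof
      fix z assume "z \<in> ?R"
      then obtain a c where z: "cmod a \<le> r" "\<forall>f. cmod (c f) \<le> r" "z = a *\<^sub>C g + (\<Sum>f\<in>F. c f *\<^sub>C f)"
        by auto
      have "(\<Sum>f\<in>F. c f *\<^sub>C f) = (\<Sum>f\<in>F. (c(g := a)) f *\<^sub>C f)"
        using insert.hyps by (intro sum.cong) auto
      then have "z = (\<Sum>f\<in>insert g F. (c(g := a)) f *\<^sub>C f)"
        using z(3) insert.hyps by simp
      moreover have "\<forall>f. cmod ((c(g := a)) f) \<le> r"
        using z by simp
      ultimately show "z \<in> ?L" by blast
    qed
  qed
  moreover have "compact ((\<lambda>a. a *\<^sub>C g) ` cball 0 r)"
    by (intro compact_continuous_image scaleC.continuous_on continuous_intros) simp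
  ultimately show ?case
    by (simp only: compact_sums insert.IH)
qed

section \<open>Compactness of the inverse\<close>

text \<open>Eigenvectors of \<open>A* A\<close>, stated without the adjoint.\<close>

definition gram_eigen :: "('a::complex_inner \<Rightarrow> 'a) \<Rightarrow> real \<Rightarrow> 'a \<Rightarrow> bool" where
  "gram_eigen A l v \<longleftrightarrow> (\<forall>x. cinner (A x) (A v) = of_real l * cinner x v)"

lemma gram_eigenD: "gram_eigen A l v \<Longrightarrow> cinner (A x) (A v) = of_real l * cinner x v"
  by (simp add: gram_eigen_def)

text \<open>The two eigenvalue equations evaluate \<open>cinner (A v) (A w)\<close> in two ways, one
  of them through conjugate symmetry; the eigenvalues are real.\<close>

lemma gram_eigen_orthogonal:
  assumes "gram_eigen A l v" "gram_eigen A m w" "l \<noteq> m"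
  shows "cinner v w = 0"
proof -
  have "of_real m * cinner v w = cnj (of_real l * cinner w v)"
    using assms(1,2) by (metis cinner_commute gram_eigenD)
  also have "\<dots> = of_real l * cinner v w"
    using cinner_commute[of v w] by simp
  finally show ?thesis using assms(3) by simp
qed

text \<open>What the inverse of \<open>T\<close> inherits. \<open>attains\<close> says in
  cross-multiplied form that the quotient of \<open>norm (A z)\<close> by \<open>norm z\<close> has
  a maximum on the preimage of \<open>M\<close>, with \<open>y\<close> certifying that this preimage
  is nontrivial. \<open>not_bounded_below\<close> encodes that \<open>T\<close> is
  unbounded.\<close>

locale attaining_operator =
  fixes A :: "'a::chilbert_space \<Rightarrow> 'a"
  assumes clinear: "bounded_clinear A"
    and injective: "A x = 0 \<Longrightarrow> x = 0"
    and attains: "closed_csubspace M \<Longrightarrow> A y \<in> M \<Longrightarrow> y \<noteq> 0 \<Longrightarrow>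
      \<exists>y0. y0 \<noteq> 0 \<and> A y0 \<in> M \<and> (\<forall>z. A z \<in> M \<longrightarrow> norm (A z) * norm y0 \<le> norm (A y0) * norm z)"
    and not_bounded_below: "\<not> (\<exists>c>0. \<forall>y. c * norm y \<le> norm (A y))"
begin

lemmas lin = bounded_clinearD[OF clinear]

lemma gram_eigen_add: "gram_eigen A l v \<Longrightarrow> gram_eigen A l w \<Longrightarrow> gram_eigen A l (v + w)"
  by (simp add: gram_eigen_def lin cinner_add_right distrib_left)

lemma gram_eigen_scaleC: "gram_eigen A l v \<Longrightarrow> gram_eigen A l (a *\<^sub>C v)"
  by (simp add: gram_eigen_def lin cinner_scaleC_right)

lemma gram_eigen_0: "gram_eigen A l 0"
  by (simp add: gram_eigen_def lin cinner.zero_right)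

lemma gram_eigen_pos:
  assumes "gram_eigen A l v" "v \<noteq> 0"
  shows "l > 0"
proof -
  have "complex_of_real ((norm (A v))\<^sup>2) = of_real (l * (norm v)\<^sup>2)"
    using gram_eigenD[OF assms(1), of v] by (simp add: cinner_self)
  then have "(norm (A v))\<^sup>2 = l * (norm v)\<^sup>2"
    using of_real_eq_iff by blast
  moreover have "(norm (A v))\<^sup>2 > 0"
    using injective assms(2) by auto
  ultimately show ?thesis
    by (metis less_eq_real_def mult_nonpos_nonneg not_less zero_le_power2)
qed

text \<open>\<open>k\<close> is the maximal Rayleigh quotient of A* A on the preimage of
  \<open>M\<close>, and the last conclusion is the Euler equation of the maximizer. It is tested
  only within that preimage, so \<open>y0\<close> is not yet known to be an eigenvector.\<close>

lemma attained_maximum: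
  assumes "closed_csubspace M" "A y \<in> M" "y \<noteq> 0"
  obtains y0 k where "y0 \<noteq> 0" "A y0 \<in> M"
    "\<And>z. A z \<in> M \<Longrightarrow> (norm (A z))\<^sup>2 \<le> k * (norm z)\<^sup>2"
    "\<And>z. A z \<in> M \<Longrightarrow> cinner (A y0) (A z) = of_real k * cinner y0 z"
proof -
  have M: "complex_vector.subspace M"
    using assms(1) by (simp add: closed_csubspace_def)
  obtain y0 where y0: "y0 \<noteq> 0" "A y0 \<in> M"
    and max: "\<And>z. A z \<in> M \<Longrightarrow> norm (A z) * norm y0 \<le> norm (A y0) * norm z"
    using attains[OF assms] by blast
  define k where "k = (norm (A y0) / norm y0)\<^sup>2"
  have k: "(norm (A y0))\<^sup>2 = k * (norm y0)\<^sup>2"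
    using y0(1) by (simp add: k_def power_divide)
  have le: "(norm (A z))\<^sup>2 \<le> k * (norm z)\<^sup>2" if "A z \<in> M" for z
  proof -
    have "norm (A z) \<le> norm (A y0) / norm y0 * norm z"
      using max[OF that] y0(1) by (simp add: field_simps)
    then show ?thesis
      unfolding k_def power_mult_distrib[symmetric] by (intro power_mono) auto
  qed
  have "cinner (A y0) (A h) = of_real k * cinner y0 h" if "A h \<in> M" for h
  proof -
    have "2 * Re (t * (cinner (A y0) (A h) - of_real k * cinner y0 h))
        \<le> (cmod t)\<^sup>2 * (k * (norm h)\<^sup>2 - (norm (A h))\<^sup>2)" for t
    proof -
      \<comment> \<open>The form is conjugate linear in its second argument, so perturbing by
        \<open>cnj t\<close> produces a first-order term linear in \<open>t\<close>.\<close>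
      have "A (y0 + cnj t *\<^sub>C h) \<in> M"
        using y0(2) that M by (simp add: lin complex_vector.subspace_add complex_vector.subspace_scale)
      from le[OF this] show ?thesis
        by (simp add: lin norm_add_square cinner_scaleC_right norm_scaleC power_mult_distrib k
            algebra_simps)
    qed
    from linear_le_quadratic_zero[OF this] show ?thesis by simp
  qed
  then show thesis
    using that y0 le by blast
qed

text \<open>Pairing \<open>A y\<close> with \<open>A f\<close> only multiplies
  \<open>cinner y f\<close> by a nonzero eigenvalue. This makes norm attainment available on the
  orthogonal complement of any set of eigenvectors.\<close>

lemma preimage_orth:
  assumes "\<forall>f\<in>F. \<exists>l>0. gram_eigen A l f"
  shows "A y \<in> orth (A ` F) \<longleftrightarrow> y \<in> orth F"
proof -
  have "cinner (A y) (A f) = 0 \<longleftrightarrow> cinner y f = 0" if "f \<in> F" for f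
    using assms that gram_eigenD[of A _ f y] by fastforce
  then show ?thesis
    by (auto simp: orth_def)
qed

text \<open>The source of all further eigenvectors. Its eigenvalue \<open>k\<close> is the maximal
  Rayleigh quotient on \<open>orth F\<close>, so it also controls \<open>A\<close> there.\<close>

lemma gram_eigen_in_orth:
  assumes F: "\<forall>f\<in>F. \<exists>l>0. gram_eigen A l f" and "y \<in> orth F" "y \<noteq> 0"
  obtains k v where "v \<in> orth F" "v \<noteq> 0" "gram_eigen A k v"
    "\<And>z. z \<in> orth F \<Longrightarrow> (norm (A z))\<^sup>2 \<le> k * (norm z)\<^sup>2"
proof -
  have "A y \<in> orth (A ` F)"
    using assms preimage_orth by blast
  then obtain y0 k where y0: "y0 \<noteq> 0" "y0 \<in> orth F"
    "\<And>z. z \<in> orth F \<Longrightarrow> (norm (A z))\<^sup>2 \<le> k * (norm z)\<^sup>2"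
    "\<And>z. z \<in> orth F \<Longrightarrow> cinner (A y0) (A z) = of_real k * cinner y0 z"
    by (rule attained_maximum[OF closed_csubspace_orth _ \<open>y \<noteq> 0\<close>]) (auto simp: preimage_orth[OF F])
  \<comment> \<open>The eigenvalue equation for \<open>y0\<close> holds on \<open>orth F\<close> by maximality and is trivial on \<open>K\<close>, whose
    complement lies in \<open>orth F\<close>.\<close>
  define K where "K = {v. cinner (A v) (A y0) = 0 \<and> cinner v y0 = 0}"
  have "closed K"
    unfolding K_def
    by (intro closed_Collect_conj closed_Collect_eq continuous_intros cinner.continuous_on
        linear_continuous_on lin)
  then have K: "closed_csubspace K"
    by (auto simp: closed_csubspace_def complex_vector.subspace_def K_def lin cinner_add_left
        cinner_scaleC_left cinner.zero_left)
  have "F \<subseteq> K"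
  proof
    fix f assume "f \<in> F"
    then obtain l where "gram_eigen A l f" "cinner y0 f = 0"
      using F orthD[OF y0(2)] by blast
    then show "f \<in> K"
      unfolding K_def by (metis (mono_tags, lifting) cinner_commute complex_cnj_zero gram_eigenD
          mem_Collect_eq mult_zero_right)
  qed
  have "cinner (A x) (A y0) = of_real k * cinner x y0" for x
  proof -
    obtain v where v: "v \<in> K" "x - v \<in> orth K"
      using closed_csubspace_projection[OF K] by blast
    then have "x - v \<in> orth F"
      using \<open>F \<subseteq> K\<close> by (auto simp: orth_def)
    from y0(4)[OF this] have "cinner (A (x - v)) (A y0) = of_real k * cinner (x - v) y0"
      by (metis cinner_commute complex_cnj_complex_of_real complex_cnj_mult)
    then show ?thesis
      using v(1) by (simp add: K_def lin cinner.diff_left)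
  qed
  then show thesis
    using that y0(1-3) unfolding gram_eigen_def by blast
qed

text \<open>Eigenvectors for distinct eigenvalues are orthogonal, so on finite sums both squared
  norms are diagonal and compare term by term. Totality makes these sums dense, and the inequality
  passes to limits.\<close>

lemma bounded_below_if_total:
  assumes "\<epsilon> > 0" and G: "\<forall>g\<in>G. \<exists>l\<ge>\<epsilon>. gram_eigen A l g" and "orth G = {0}"
  shows "\<epsilon> * (norm y)\<^sup>2 \<le> (norm (A y))\<^sup>2"
proof -
  \<comment> \<open>Finite sums of eigenvectors, with at most one summand for each eigenvalue so that the summands
    are orthogonal.\<close>
  define good where "good L g \<longleftrightarrow> finite L \<and> (\<forall>l\<in>L. \<epsilon> \<le> l) \<and> (\<forall>l. gram_eigen A l (g l)) \<and> (\<forall>l. l \<notin> L \<longrightarrow> g l = 0)"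
    for L :: "real set" and g :: "real \<Rightarrow> 'a"
  define W where "W = {x. \<exists>L g. good L g \<and> x = (\<Sum>l\<in>L. g l)}"
  have W: "complex_vector.subspace W"
    unfolding complex_vector.subspace_def
  proof (intro conjI ballI allI)
    show "0 \<in> W"
      unfolding W_def good_def by (force intro: exI[of _ "{}"] gram_eigen_0)
  next
    fix x y assume "x \<in> W" "y \<in> W"
    then obtain L g L' g' where *: "good L g" "x = (\<Sum>l\<in>L. g l)" "good L' g'" "y = (\<Sum>l\<in>L'. g' l)"
      unfolding W_def by blast
    \<comment> \<open>The summands vanish outside their index sets, so both sums can be taken over
      the union.\<close>
    have "x = (\<Sum>l\<in>L \<union> L'. g l)" "y = (\<Sum>l\<in>L \<union> L'. g' l)"
      using * unfolding good_def by (auto intro!: sum.mono_neutral_left)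
    then have "x + y = (\<Sum>l\<in>L \<union> L'. g l + g' l)"
      by (simp add: sum.distrib)
    moreover have "good (L \<union> L') (\<lambda>l. g l + g' l)"
      using * unfolding good_def by (auto intro: gram_eigen_add)
    ultimately show "x + y \<in> W"
      unfolding W_def by blast
  next
    fix a x assume "x \<in> W"
    then obtain L g where *: "good L g" "x = (\<Sum>l\<in>L. g l)"
      unfolding W_def by blast
    then have "good L (\<lambda>l. a *\<^sub>C g l)"
      unfolding good_def by (auto intro: gram_eigen_scaleC)
    moreover have "a *\<^sub>C x = (\<Sum>l\<in>L. a *\<^sub>C g l)"
      using *(2) by (simp add: scaleC.sum_right)
    ultimately show "a *\<^sub>C x \<in> W"
      unfolding W_def by blast
  qed
  have "G \<subseteq> W"
  proof
    fix v assume "v \<in> G"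
    then obtain l where "\<epsilon> \<le> l" "gram_eigen A l v" using G by blast
    then have "good {l} (\<lambda>m. if m = l then v else 0)"
      unfolding good_def by (auto intro: gram_eigen_0)
    then show "v \<in> W"
      unfolding W_def by force
  qed
  have "v \<in> closure W" for v
  proof -
    obtain w where w: "w \<in> closure W" "v - w \<in> orth (closure W)"
      using closed_csubspace_projection[OF closed_csubspace_closure[OF W]] by blast
    then have "v - w \<in> orth G"
      using \<open>G \<subseteq> W\<close> closure_subset[of W] by (auto simp: orth_def)
    then show ?thesis
      using assms(3) w(1) by simp
  qed
  moreover have "closure W \<subseteq> {y. \<epsilon> * (norm y)\<^sup>2 \<le> (norm (A y))\<^sup>2}"
  proof (rule closure_minimal)
    show "closed {y. \<epsilon> * (norm y)\<^sup>2 \<le> (norm (A y))\<^sup>2}"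
      by (intro closed_Collect_le continuous_intros linear_continuous_on lin)
    show "W \<subseteq> {y. \<epsilon> * (norm y)\<^sup>2 \<le> (norm (A y))\<^sup>2}"
    proof safe
      fix x assume "x \<in> W"
      then obtain L g where *: "good L g" and x: "x = (\<Sum>l\<in>L. g l)"
        unfolding W_def by blast
      then have fin: "finite L" and eig: "\<And>l. gram_eigen A l (g l)" and ge: "\<And>l. l \<in> L \<Longrightarrow> \<epsilon> \<le> l"
        by (auto simp: good_def)
      have x_g: "cinner x (g m) = of_real ((norm (g m))\<^sup>2)" if "m \<in> L" for m
      proof -
        have "cinner x (g m) = (\<Sum>l\<in>L. if l = m then cinner (g m) (g m) else 0)"
          unfolding x cinner.sum_left
          by (intro sum.cong) (auto intro: gram_eigen_orthogonal[OF eig eig])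
        then show ?thesis
          using fin that by (simp add: cinner_self)
      qed
      have "cinner x x = (\<Sum>m\<in>L. cinner x (g m))"
        by (subst (2) x) (rule cinner.sum_right)
      also have "\<dots> = of_real (\<Sum>m\<in>L. (norm (g m))\<^sup>2)"
        by (simp add: x_g)
      finally have 1: "(norm x)\<^sup>2 = (\<Sum>m\<in>L. (norm (g m))\<^sup>2)"
        unfolding cinner_self of_real_eq_iff .
      have "A x = (\<Sum>m\<in>L. A (g m))"
        unfolding x by (rule linear_sum[OF bounded_linear.linear[OF lin(1)]])
      then have "cinner (A x) (A x) = (\<Sum>m\<in>L. cinner (A x) (A (g m)))"
        by (metis cinner.sum_right)
      also have "\<dots> = of_real (\<Sum>m\<in>L. m * (norm (g m))\<^sup>2)"
        by (simp add: x_g gram_eigenD[OF eig])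
      finally have 2: "(norm (A x))\<^sup>2 = (\<Sum>m\<in>L. m * (norm (g m))\<^sup>2)"
        unfolding cinner_self of_real_eq_iff .
      show "\<epsilon> * (norm x)\<^sup>2 \<le> (norm (A x))\<^sup>2"
        unfolding 1 2 sum_distrib_left by (intro sum_mono mult_right_mono ge) auto
    qed
  qed
  ultimately show ?thesis by blast
qed

text \<open>If \<open>F\<close> and all eigenvectors with eigenvalue at least
  \<open>\<epsilon>\<close> were total together, \<open>A\<close> would be bounded below. So some
  nonzero vector is orthogonal to all of them, and an eigenvector found in that complement must have
  eigenvalue below \<open>\<epsilon>\<close>.\<close>

lemma small_gram_eigen:
  assumes "finite F" and F: "\<forall>f\<in>F. \<exists>l>0. gram_eigen A l f" and "\<epsilon> > 0"
  shows "\<exists>v l. norm v = 1 \<and> v \<in> orth F \<and> l < \<epsilon> \<and> gram_eigen A l v"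
proof -
  define G where "G = F \<union> {g. \<exists>l\<ge>\<epsilon>. gram_eigen A l g}"
  \<comment> \<open>Finiteness of \<open>F\<close> enters here: its positive eigenvalues have a
    common positive lower bound.\<close>
  have "\<exists>\<delta>>0. \<forall>f\<in>F. \<exists>l\<ge>\<delta>. gram_eigen A l f"
    using assms(1) F
  proof (induction F rule: finite_induct)
    case empty
    then show ?case by (auto intro: exI[of _ 1])
  next
    case (insert g F)
    then obtain \<delta> l where "\<delta> > 0" "\<forall>f\<in>F. \<exists>l\<ge>\<delta>. gram_eigen A l f" "l > 0" "gram_eigen A l g"
      by auto
    then show ?case
      by (intro exI[of _ "min \<delta> l"]) (auto intro: min.cobounded2, meson min.coboundedI1)
  qed
  then obtain \<delta> where \<delta>: "\<delta> > 0" "\<forall>f\<in>F. \<exists>l\<ge>\<delta>. gram_eigen A l f" by blast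
  have "orth G \<noteq> {0}"
  proof
    assume "orth G = {0}"
    moreover have "\<forall>g\<in>G. \<exists>l\<ge>min \<delta> \<epsilon>. gram_eigen A l g"
      using \<delta>(2) unfolding G_def by (auto, meson min.coboundedI1, meson min.coboundedI2)
    ultimately have *: "min \<delta> \<epsilon> * (norm y)\<^sup>2 \<le> (norm (A y))\<^sup>2" for y
      using \<delta>(1) assms(3) by (intro bounded_below_if_total) auto
    have "sqrt (min \<delta> \<epsilon>) * norm y \<le> norm (A y)" for y
      using real_sqrt_le_mono[OF *[of y]] by (simp add: real_sqrt_mult)
    then show False
      using not_bounded_below \<delta>(1) assms(3) by (metis min_less_iff_conj real_sqrt_gt_zero)
  qed
  moreover have "0 \<in> orth G"
    by (simp add: orth_def cinner.zero_left)
  ultimately obtain y where "y \<in> orth G" "y \<noteq> 0" by blast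
  moreover have "\<forall>g\<in>G. \<exists>l>0. gram_eigen A l g"
    using F assms(3) unfolding G_def by (auto intro: less_le_trans)
  ultimately obtain k v where v: "v \<in> orth G" "v \<noteq> 0" "gram_eigen A k v"
    by (metis gram_eigen_in_orth)
  have "cinner v v \<noteq> 0"
    using v(2) by (simp add: cinner_self)
  then have "v \<notin> G"
    using orthD[OF v(1)] by blast
  then have "k < \<epsilon>"
    using v(3) unfolding G_def by (simp add: not_le[symmetric]) blast
  have "complex_of_real (inverse (norm v)) *\<^sub>C v \<in> orth F"
    using v(1) by (auto simp: orth_def G_def cinner_scaleC_left)
  moreover have "norm (complex_of_real (inverse (norm v)) *\<^sub>C v) = 1"
    using v(2) by (simp add: norm_scaleC norm_inverse)
  ultimately show ?thesis
    using gram_eigen_scaleC[OF v(3)] \<open>k < \<epsilon>\<close> by blast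
qed

text \<open>The squared norms \<open>t n\<close> of \<open>A (q n)\<close> increase towards
  \<open>\<beta>\<close> without reaching it. A maximizer on the preimage of \<open>M\<close> then
  has no component along any \<open>q n\<close>, which leaves no room for it.\<close>

lemma finite_large_gram_eigen:
  fixes e :: "nat \<Rightarrow> 'a"
  assumes "\<beta> > 0" and e: "\<And>n. norm (e n) = 1 \<and> (\<exists>l\<ge>\<beta>. gram_eigen A l (e n))"
    and orth_e: "\<And>m n. m \<noteq> n \<Longrightarrow> cinner (e m) (e n) = 0"
  shows False
proof -
  obtain \<nu> where \<nu>: "\<And>n. \<beta> \<le> \<nu> n" "\<And>n. gram_eigen A (\<nu> n) (e n)"
    using e by metis
  obtain f :: "nat \<Rightarrow> 'a" where f: "\<And>n. norm (f n) = 1 \<and> (\<exists>l<\<beta> / 2. gram_eigen A l (f n))"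
    and orth_f: "\<And>m n. m \<noteq> n \<Longrightarrow> cinner (f m) (f n) = 0"
  proof (rule orthogonal_sequence)
    fix F :: "'a set"
    assume "finite F" and *: "\<forall>f\<in>F. norm f = 1 \<and> (\<exists>l<\<beta> / 2. gram_eigen A l f)"
    have "\<forall>f\<in>F. \<exists>l>0. gram_eigen A l f"
      using * gram_eigen_pos by (metis norm_zero zero_neq_one)
    from small_gram_eigen[OF \<open>finite F\<close> this, of "\<beta> / 2"]
    show "\<exists>v. (norm v = 1 \<and> (\<exists>l<\<beta> / 2. gram_eigen A l v)) \<and> v \<in> orth F"
      using \<open>\<beta> > 0\<close> by auto
  qed blast
  obtain \<mu> where \<mu>: "\<And>n. \<mu> n < \<beta> / 2" "\<And>n. gram_eigen A (\<mu> n) (f n)"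
    using f by metis
  have "e n \<noteq> 0" "f n \<noteq> 0" for n
    using e[of n] f[of n] by (metis norm_zero zero_neq_one)+
  then have \<mu>_pos: "\<mu> n > 0" and \<nu>_pos: "\<nu> n > 0" for n
    using gram_eigen_pos \<mu>(2) \<nu>(2) by blast+
  have \<mu>\<nu>: "\<mu> n < \<nu> m" for m n
    using \<mu>(1)[of n] \<nu>(1)[of m] assms(1) by linarith
  have orth_ef: "cinner (e m) (f n) = 0" "cinner (f n) (e m) = 0" for m n
    using gram_eigen_orthogonal[OF \<nu>(2)[of m] \<mu>(2)[of n]]
      gram_eigen_orthogonal[OF \<mu>(2)[of n] \<nu>(2)[of m]] \<mu>\<nu>[of n m] by auto
  have ee: "cinner (e m) (e n) = (if m = n then 1 else 0)"
    and ff: "cinner (f m) (f n) = (if m = n then 1 else 0)" for m n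
    using e f orth_e orth_f by (auto simp: cinner_self)
  \<comment> \<open>A strictly increasing sequence from \<open>\<beta> / 2\<close> towards
    \<open>\<beta>\<close>. Its values separate the \<open>\<mu> n\<close> from the
    \<open>\<nu> n\<close>, so each \<open>t n\<close> is a proper convex combination of
    \<open>\<mu> n\<close> and \<open>\<nu> n\<close>.\<close>
  define t where "t n = \<beta> * (1 - 1 / (real n + 2))" for n
  have t_mono: "t n < t (Suc n)" for n
    unfolding t_def using assms(1) by (intro mult_strict_left_mono) (auto simp: field_simps)
  have t_bounds: "\<beta> / 2 \<le> t n" "t n < \<beta>" for n
    using assms(1) by (auto simp: t_def field_simps)
  \<comment> \<open>\<open>s n\<close> is the weight of \<open>e n\<close> in \<open>q n\<close> for which \<open>A (q n)\<close> has squared norm \<open>t n\<close>.\<close>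
  define s where "s n = (t n - \<mu> n) / (\<nu> n - \<mu> n)" for n
  have s: "0 < s n" "s n < 1" "s n * \<nu> n + (1 - s n) * \<mu> n = t n" for n
  proof -
    have "\<nu> n - \<mu> n > 0" "t n - \<mu> n > 0" "t n < \<nu> n"
      using \<mu>\<nu>[of n n] \<mu>(1)[of n] t_bounds[of n] \<nu>(1)[of n] by auto
    then have *: "0 < s n" "s n < 1" "s n * (\<nu> n - \<mu> n) = t n - \<mu> n"
      unfolding s_def by (auto simp: divide_less_eq)
    then show "0 < s n" "s n < 1" "s n * \<nu> n + (1 - s n) * \<mu> n = t n"
      by (auto simp: algebra_simps)
  qed
  define a where "a n = complex_of_real (sqrt (s n))" for n
  define b where "b n = complex_of_real (sqrt (1 - s n))" for n
  have aa: "a n * a n = of_real (s n)" and bb: "b n * b n = of_real (1 - s n)" for n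
    unfolding a_def b_def of_real_mult[symmetric] using s[of n] by auto
  have cnj_ab [simp]: "cnj (a n) = a n" "cnj (b n) = b n" for n
    by (auto simp: a_def b_def)
  have nz: "of_real (\<nu> n) \<noteq> (0::complex)" "of_real (\<mu> n) \<noteq> (0::complex)" for n
    using \<nu>_pos[of n] \<mu>_pos[of n] by auto
  \<comment> \<open>Within the span of \<open>e n\<close> and \<open>f n\<close>, the vectors orthogonal to \<open>A* A (p n)\<close> are the multiples of \<open>q n\<close>.\<close>
  define q where "q n = a n *\<^sub>C e n + b n *\<^sub>C f n" for n
  define p where "p n = (b n / of_real (\<nu> n)) *\<^sub>C e n - (a n / of_real (\<mu> n)) *\<^sub>C f n" for n
  have Aq: "cinner (A x) (A (q n)) = a n * of_real (\<nu> n) * cinner x (e n) + b n * of_real (\<mu> n) * cinner x (f n)"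
    for x n
    unfolding q_def by (simp add: lin cinner_add_right cinner_scaleC_right gram_eigenD[OF \<nu>(2)]
        gram_eigenD[OF \<mu>(2)])
  have Ap: "cinner (A x) (A (p n)) = b n * cinner x (e n) - a n * cinner x (f n)" for x n
    unfolding p_def using nz by (simp add: lin cinner.diff_right cinner_scaleC_right
        gram_eigenD[OF \<nu>(2)] gram_eigenD[OF \<mu>(2)])
  have xq: "cinner x (q n) = a n * cinner x (e n) + b n * cinner x (f n)" for x n
    unfolding q_def by (simp add: cinner_add_right cinner_scaleC_right)
  have qe: "cinner (q m) (e n) = (if m = n then a m else 0)"
    and qf: "cinner (q m) (f n) = (if m = n then b m else 0)" for m n
    unfolding q_def by (auto simp: cinner_add_left cinner_scaleC_left ee ff orth_ef)
  have "cinner (q n) (q n) = 1" for n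
    by (simp add: xq qe qf aa bb)
  then have norm_q: "(norm (q n))\<^sup>2 = 1" for n
    unfolding cinner_self by (metis of_real_1 of_real_eq_iff)
  have "cinner (A (q n)) (A (q n)) = of_real (\<nu> n) * (a n * a n) + of_real (\<mu> n) * (b n * b n)" for n
    by (simp add: Aq qe qf)
  also have "\<dots> n = of_real (t n)" for n
    unfolding aa bb s(3)[symmetric] by (simp add: algebra_simps)
  finally have norm_Aq: "(norm (A (q n)))\<^sup>2 = t n" for n
    unfolding cinner_self by (metis of_real_eq_iff)
  \<comment> \<open>\<open>G\<close> collects the remaining eigenvectors. Together with the
    \<open>p n\<close> it cuts the preimage of \<open>M\<close> down to the closed span of the
    \<open>q n\<close>.\<close>
  define G where "G = {g. (\<exists>l>0. gram_eigen A l g) \<and> (\<forall>n. cinner g (e n) = 0 \<and> cinner g (f n) = 0)}"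
  define M where "M = orth (A ` (range p \<union> G))"
  have q_M: "A (q n) \<in> M" for n
  proof -
    have "cinner (A (q n)) (A (p m)) = 0" for m
      by (simp add: Ap qe qf)
    moreover have "cinner (A (q n)) (A g) = 0" if "g \<in> G" for g
    proof -
      have g: "cinner (e n) g = 0" "cinner (f n) g = 0" "\<exists>l. gram_eigen A l g"
        using that cinner_commute[of "e n" g] cinner_commute[of "f n" g] by (auto simp: G_def)
      then have "cinner (q n) g = 0"
        by (simp add: q_def cinner_add_left cinner_scaleC_left)
      then show ?thesis
        using g(3) gram_eigenD by fastforce
    qed
    ultimately show ?thesis
      by (auto simp: M_def orth_def)
  qed
  have "q 0 \<noteq> 0"
    using norm_q[of 0] by auto
  with q_M[of 0] obtain y k where y: "y \<noteq> 0" "A y \<in> M"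
    and k_max: "\<And>z. A z \<in> M \<Longrightarrow> (norm (A z))\<^sup>2 \<le> k * (norm z)\<^sup>2"
    and k_eq: "\<And>z. A z \<in> M \<Longrightarrow> cinner (A y) (A z) = of_real k * cinner y z"
    using attained_maximum[of M "q 0"] closed_csubspace_orth unfolding M_def by metis
  have ye: "cinner y (e n) = 0 \<and> cinner y (f n) = 0" for n
  proof -
    have "cinner (A y) (A (p n)) = 0"
      using y(2) by (auto simp: M_def orth_def)
    then have *: "b n * cinner y (e n) = a n * cinner y (f n)"
      by (simp add: Ap)
    \<comment> \<open>The relation just found makes the coefficients of \<open>y\<close> at
      \<open>e n\<close> and \<open>f n\<close> proportional to \<open>a n\<close> and
      \<open>b n\<close>; the factor is \<open>d\<close>, because the squares of \<open>a n\<close>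
      and \<open>b n\<close> sum to 1.\<close>
    define d where "d = cinner y (q n)"
    have "a n * d = (a n * a n) * cinner y (e n) + b n * (a n * cinner y (f n))"
      by (simp add: d_def xq algebra_simps)
    also have "\<dots> = (a n * a n + b n * b n) * cinner y (e n)"
      unfolding *[symmetric] by (simp add: algebra_simps)
    finally have e_d: "cinner y (e n) = a n * d"
      by (simp add: aa bb)
    have "b n * d = a n * (b n * cinner y (e n)) + (b n * b n) * cinner y (f n)"
      by (simp add: d_def xq algebra_simps)
    also have "\<dots> = (a n * a n + b n * b n) * cinner y (f n)"
      unfolding * by (simp add: algebra_simps)
    finally have f_d: "cinner y (f n) = b n * d"
      by (simp add: aa bb)
    \<comment> \<open>The Euler equation tested at \<open>q n\<close> equates \<open>k\<close> with
      \<open>t n\<close> unless \<open>d = 0\<close>, while \<open>k\<close> is at least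
      \<open>t (Suc n)\<close> because \<open>q (Suc n)\<close> competes as well.\<close>
    have "of_real k * d = of_real (\<nu> n) * (a n * a n) * d + of_real (\<mu> n) * (b n * b n) * d"
      using k_eq[OF q_M[of n]] by (simp add: Aq e_d f_d d_def[symmetric] algebra_simps)
    also have "\<dots> = of_real (t n) * d"
      unfolding aa bb s(3)[symmetric] by (simp add: algebra_simps)
    finally have "of_real k * d = of_real (t n) * d" .
    moreover have "t n < k"
      using t_mono[of n] k_max[OF q_M[of "Suc n"]] by (simp add: norm_q norm_Aq)
    ultimately have "d = 0" by simp
    then show ?thesis
      by (simp add: e_d f_d)
  qed
  \<comment> \<open>Since \<open>y\<close> is orthogonal to all of \<open>F\<close>, there is an
    eigenvector in \<open>orth F\<close>. It belongs to \<open>G\<close> by construction and is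
    therefore orthogonal to itself.\<close>
  define F where "F = range e \<union> range f \<union> G"
  have F: "\<forall>f\<in>F. \<exists>l>0. gram_eigen A l f"
    using \<nu>(2) \<mu>(2) \<nu>_pos \<mu>_pos by (auto simp: F_def G_def) blast
  have "\<forall>g\<in>G. \<exists>l>0. gram_eigen A l g"
    by (auto simp: G_def)
  then have "y \<in> orth G"
    using y(2) preimage_orth[of G y] by (auto simp: M_def orth_def)
  then have "y \<in> orth F"
    using ye by (auto simp: F_def orth_def)
  then obtain v l where v: "v \<in> orth F" "v \<noteq> 0" "gram_eigen A l v"
    by (rule gram_eigen_in_orth[OF F _ y(1)]) blast
  then have "v \<in> G"
    using gram_eigen_pos[OF v(3,2)] unfolding G_def orth_def F_def by blast
  then have "cinner v v = 0"
    using orthD[OF v(1)] by (auto simp: F_def)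
  then show False
    using v(2) by (simp add: cinner_self)
qed

text \<open>Infinite orthonormal families with eigenvalues at least \<open>\<beta>\<close> are
  excluded, so some finite one cannot be enlarged. On its complement the maximal Rayleigh quotient
  is an eigenvalue, hence below \<open>\<beta>\<close>.\<close>

lemma almost_finite_rank:
  assumes "\<beta> > 0"
  obtains F where "finite F" "\<And>f. f \<in> F \<Longrightarrow> norm f = 1"
    "\<And>f g. f \<in> F \<Longrightarrow> g \<in> F \<Longrightarrow> f \<noteq> g \<Longrightarrow> cinner f g = 0"
    "\<And>z. z \<in> orth F \<Longrightarrow> (norm (A z))\<^sup>2 \<le> \<beta> * (norm z)\<^sup>2"
proof -
  define P where "P v \<longleftrightarrow> norm v = 1 \<and> (\<exists>l\<ge>\<beta>. gram_eigen A l v)" for v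
  have "\<exists>F. finite F \<and> (\<forall>f\<in>F. P f) \<and> (\<forall>f\<in>F. \<forall>g\<in>F. f \<noteq> g \<longrightarrow> cinner f g = 0) \<and>
      \<not> (\<exists>v. P v \<and> v \<in> orth F)"
  proof (rule ccontr)
    assume *: "\<not> ?thesis"
    show False
    proof (rule orthogonal_sequence[of P])
      show "\<exists>v. P v \<and> v \<in> orth F"
        if "finite F" "\<forall>f\<in>F. P f" "\<forall>f\<in>F. \<forall>g\<in>F. f \<noteq> g \<longrightarrow> cinner f g = 0" for F
        using * that by metis
    next
      fix e :: "nat \<Rightarrow> 'a"
      assume "\<And>n. P (e n)" "\<And>m n. m \<noteq> n \<Longrightarrow> cinner (e m) (e n) = 0"
      then show False
        using finite_large_gram_eigen[OF assms, of e] unfolding P_def by metis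
    qed
  qed
  then obtain F where F: "finite F" "\<forall>f\<in>F. P f" "\<forall>f\<in>F. \<forall>g\<in>F. f \<noteq> g \<longrightarrow> cinner f g = 0"
    and no: "\<not> (\<exists>v. P v \<and> v \<in> orth F)"
    by blast
  have "(norm (A z))\<^sup>2 \<le> \<beta> * (norm z)\<^sup>2" if z: "z \<in> orth F" for z
  proof (cases "z = 0")
    case True
    then show ?thesis by (simp add: lin)
  next
    case False
    have "\<forall>f\<in>F. \<exists>l>0. gram_eigen A l f"
      using F(2) assms unfolding P_def by (meson less_le_trans)
    then obtain k v where v: "v \<in> orth F" "v \<noteq> 0" "gram_eigen A k v"
      and le: "\<And>z. z \<in> orth F \<Longrightarrow> (norm (A z))\<^sup>2 \<le> k * (norm z)\<^sup>2"
      by (rule gram_eigen_in_orth[OF _ z False]) blast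
    define u where "u = complex_of_real (inverse (norm v)) *\<^sub>C v"
    have "norm u = 1" "gram_eigen A k u" "u \<in> orth F"
      using v by (auto simp: u_def norm_scaleC norm_inverse orth_def cinner_scaleC_left
          intro: gram_eigen_scaleC)
    then have "k < \<beta>"
      using no unfolding P_def by (meson not_le)
    then show ?thesis
      using le[OF that] by (meson less_imp_le mult_right_mono order_trans zero_le_power2)
  qed
  then show thesis
    using that F unfolding P_def by blast
qed

text \<open>\<open>A\<close> is small on the complement of a finite orthonormal family, so replacing
  \<open>y\<close> by its projection \<open>w\<close> onto the span changes \<open>A y\<close> by
  less than \<open>\<epsilon>\<close>. The images of these projections lie in a compact set.\<close>

theorem compact_image_cball: "compact (closure (A ` cball 0 r))"
proof (rule compact_closure_if_near_compact)
  fix \<epsilon> :: real assume "\<epsilon> > 0"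
  define \<delta> where "\<delta> = \<epsilon> / (\<bar>r\<bar> + 1)"
  have \<delta>: "\<delta> > 0" "\<delta> * \<bar>r\<bar> < \<epsilon>"
    using \<open>\<epsilon> > 0\<close> by (auto simp: \<delta>_def field_simps)
  obtain F where F: "finite F" "\<And>f. f \<in> F \<Longrightarrow> norm f = 1"
    "\<And>f g. f \<in> F \<Longrightarrow> g \<in> F \<Longrightarrow> f \<noteq> g \<Longrightarrow> cinner f g = 0"
    "\<And>z. z \<in> orth F \<Longrightarrow> (norm (A z))\<^sup>2 \<le> \<delta>\<^sup>2 * (norm z)\<^sup>2"
    using almost_finite_rank[of "\<delta>\<^sup>2"] \<delta>(1) by (metis zero_less_power)
  define C where "C = A ` {\<Sum>f\<in>F. c f *\<^sub>C f | c. \<forall>f. cmod (c f) \<le> \<bar>r\<bar>}"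
  have "compact C"
    unfolding C_def
    by (intro compact_continuous_image linear_continuous_on lin compact_bounded_combinations F)
  moreover have "\<exists>c\<in>C. dist c (A y) < \<epsilon>" if "y \<in> cball 0 r" for y
  proof -
    have y: "norm y \<le> \<bar>r\<bar>" using that by simp
    \<comment> \<open>The value 0 outside \<open>F\<close> is chosen because
      \<open>compact_bounded_combinations\<close> bounds the coefficients at every index.\<close>
    define c where "c f = (if f \<in> F then cinner y f else 0)" for f
    define w where "w = (\<Sum>f\<in>F. c f *\<^sub>C f)"
    have "cmod (c f) \<le> \<bar>r\<bar>" for f
      using norm_cinner_le[of y f] F(2)[of f] y by (auto simp: c_def)
    then have "A w \<in> C"
      unfolding C_def w_def by blast
    have "cinner w g = cinner y g" if "g \<in> F" for g
    proof -
      have "cinner w g = (\<Sum>f\<in>F. if f = g then cinner y g else 0)"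
        unfolding w_def cinner.sum_left using that F(2,3)
        by (intro sum.cong) (auto simp: cinner_scaleC_left cinner_self c_def)
      then show ?thesis
        using F(1) that by simp
    qed
    then have orth: "y - w \<in> orth F"
      by (simp add: orth_def cinner.diff_left)
    then have "cinner (y - w) w = 0"
      unfolding w_def[unfolded c_def] cinner.sum_right
      by (intro sum.neutral) (simp add: cinner_scaleC_right orth_def w_def c_def)
    then have "(norm (y - w))\<^sup>2 \<le> (norm y)\<^sup>2"
      using norm_add_square[of "y - w" w] by simp
    then have "norm (y - w) \<le> \<bar>r\<bar>"
      using y by (meson abs_norm_cancel norm_ge_zero order_trans power2_le_imp_le)
    moreover have "norm (A (y - w)) \<le> \<delta> * norm (y - w)"
      using F(4)[OF orth] \<delta>(1) by (metis (no_types) less_imp_le mult_nonneg_nonneg norm_ge_zero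
          power2_le_imp_le power_mult_distrib)
    ultimately have "norm (A (y - w)) < \<epsilon>"
      using \<delta> by (meson less_imp_le mult_left_mono order_le_less_trans order_trans)
    then show ?thesis
      using \<open>A w \<in> C\<close> by (auto simp: dist_norm lin norm_minus_commute)
  qed
  ultimately show "\<exists>C. compact C \<and> (\<forall>x\<in>A ` cball 0 r. \<exists>c\<in>C. dist c x < \<epsilon>)"
    by blast
qed

end

section \<open>Compact operators without nonzero eigenvalues\<close>

locale compact_operator =
  fixes A :: "'a::chilbert_space \<Rightarrow> 'a"
  assumes clinear: "bounded_clinear A"
    and compact_image: "compact (closure (A ` cball 0 r))"
begin

lemmas lin = bounded_clinearD[OF clinear]

lemma norm_bound: obtains K where "K > 0" "\<And>x. norm (A x) \<le> K * norm x"
  using bounded_linear.pos_bounded[OF lin(1)] by (metis mult.commute)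

lemma convergent_subsequence:
  assumes "\<And>n. norm (x n) \<le> r"
  obtains l s where "strict_mono (s :: nat \<Rightarrow> nat)" "(\<lambda>n. A (x (s n))) \<longlonglongrightarrow> l"
proof -
  have "seq_compact (closure (A ` cball 0 r))"
    using compact_image compact_imp_seq_compact by blast
  moreover have "\<forall>n. A (x n) \<in> closure (A ` cball 0 r)"
    using assms closure_subset by fastforce
  ultimately obtain l and s :: "nat \<Rightarrow> nat" where "strict_mono s" "((\<lambda>n. A (x n)) \<circ> s) \<longlonglongrightarrow> l"
    by (rule seq_compactE)
  then show thesis
    using that by (simp add: comp_def)
qed

end

locale compact_operator_no_eigenvalue = compact_operator +
  assumes no_eigenvalue: "l \<noteq> 0 \<Longrightarrow> A v = l *\<^sub>C v \<Longrightarrow> v = 0"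
begin

text \<open>\<open>w\<close> is the reciprocal of the spectral parameter. The family is the identity
  at \<open>w = 0\<close>, and without nonzero eigenvalues of \<open>A\<close> its inverse will
  exist on the whole plane.\<close>

definition pencil :: "complex \<Rightarrow> 'a \<Rightarrow> 'a" where
  "pencil w x = x - w *\<^sub>C A x"

lemma pencil_diff: "pencil w (x - y) = pencil w x - pencil w y"
  by (simp add: pencil_def lin scaleC.diff_right)

lemma pencil_shift: "pencil w x = pencil v x - (w - v) *\<^sub>C A x"
  by (simp add: pencil_def scaleC.diff_left)

text \<open>Unit vectors nearly annihilated by the pencil would, by compactness of \<open>A\<close>,
  have a subsequence converging to a unit eigenvector of \<open>A\<close> for
  \<open>1 / w\<close>.\<close>

lemma pencil_bounded_below: "\<exists>c>0. \<forall>x. c * norm x \<le> norm (pencil w x)"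
proof (rule ccontr)
  assume *: "\<not> ?thesis"
  have "\<exists>u. norm u = 1 \<and> norm (pencil w u) < 1 / real (Suc n)" for n
  proof -
    obtain x where x: "norm (pencil w x) < 1 / real (Suc n) * norm x"
      using * by (metis not_le of_nat_0_less_iff zero_less_Suc zero_less_divide_1_iff)
    define a where "a = complex_of_real (inverse (norm x))"
    have nz: "norm x > 0"
      using x by (cases "x = 0") (auto simp: pencil_def lin)
    have na: "cmod a = inverse (norm x)"
      by (simp add: a_def norm_inverse)
    have "pencil w (a *\<^sub>C x) = a *\<^sub>C pencil w x"
      by (simp add: pencil_def lin scaleC.diff_right scaleC_scaleC mult.commute)
    moreover have "norm (a *\<^sub>C pencil w x) < 1 / real (Suc n)"
      using x nz by (simp add: norm_scaleC na field_simps)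
    moreover have "norm (a *\<^sub>C x) = 1"
      using nz by (simp add: norm_scaleC na)
    ultimately show ?thesis by metis
  qed
  then obtain u where u: "\<And>n. norm (u n) = 1" "\<And>n. norm (pencil w (u n)) < 1 / real (Suc n)"
    by metis
  obtain l s where s: "strict_mono s" and l: "(\<lambda>n. A (u (s n))) \<longlonglongrightarrow> l"
    using convergent_subsequence[of u 1] u(1) by (metis order_refl)
  have "(\<lambda>n. pencil w (u n)) \<longlonglongrightarrow> 0"
  proof (rule Lim_null_comparison)
    show "\<forall>\<^sub>F n in sequentially. norm (pencil w (u n)) \<le> inverse (real (Suc n))"
      using u(2) by (auto simp: inverse_eq_divide intro!: always_eventually less_imp_le)
  qed (rule LIMSEQ_inverse_real_of_nat)
  \<comment> \<open>Each \<open>u (s n)\<close> is the sum of its pencil value and a multiple of its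
    image, so convergence of the images carries over to the vectors themselves.\<close>
  then have "(\<lambda>n. pencil w (u (s n)) + w *\<^sub>C A (u (s n))) \<longlonglongrightarrow> 0 + w *\<^sub>C l"
    using LIMSEQ_subseq_LIMSEQ[OF _ s] by (intro tendsto_add scaleC.tendsto l) (auto simp: comp_def)
  then have lim: "(\<lambda>n. u (s n)) \<longlonglongrightarrow> w *\<^sub>C l"
    by (simp add: pencil_def)
  from tendsto_norm[OF this] have "norm (w *\<^sub>C l) = 1"
    by (simp add: u(1) LIMSEQ_const_iff)
  then have nz: "w \<noteq> 0" "l \<noteq> 0"
    by (auto simp: norm_scaleC)
  have "(\<lambda>n. A (u (s n))) \<longlonglongrightarrow> A (w *\<^sub>C l)"
    by (rule bounded_linear.tendsto[OF lin(1) lim])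
  then have "l = w *\<^sub>C A l"
    using LIMSEQ_unique[OF l] unfolding lin(2) by blast
  then have "(1 / w) *\<^sub>C l = (1 / w) *\<^sub>C (w *\<^sub>C A l)"
    by (rule arg_cong)
  then have "A l = (1 / w) *\<^sub>C l"
    using nz(1) by (simp add: scaleC_scaleC)
  then show False
    using no_eigenvalue[of "1/w" l] nz by simp
qed

lemma pencil_inj: "pencil w x = pencil w y \<Longrightarrow> x = y"
proof -
  assume "pencil w x = pencil w y"
  then have "pencil w (x - y) = 0" by (simp add: pencil_diff)
  moreover obtain c where "c > 0" "c * norm (x - y) \<le> norm (pencil w (x - y))"
    using pencil_bounded_below[of w] by blast
  ultimately show "x = y"
    by (simp add: mult_le_0_iff)
qed

text \<open>\<open>pencil w x = y\<close> is rewritten as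
  \<open>pencil v x = y + (w - v) *\<^sub>C A x\<close>; inverting \<open>pencil v\<close> turns
  this into the fixed point equation of a contraction.\<close>

lemma surj_pencil_perturb:
  assumes K: "K > 0" "\<And>x. norm (A x) \<le> K * norm x" and c: "\<And>x. c * norm x \<le> norm (pencil v x)" "c > 0"
    and "surj (pencil v)" and near: "cmod (w - v) * K < c"
  shows "surj (pencil w)"
proof -
  have "\<exists>x. pencil w x = y" for y
  proof -
    define R where "R = inv (pencil v)"
    have R: "pencil v (R z) = z" for z
      unfolding R_def by (rule surj_f_inv_f) fact
    define g where "g x = R (y + (w - v) *\<^sub>C A x)" for x
    have "\<exists>!x. g x = x"
    proof (rule banach_fix_type)
      show "0 \<le> cmod (w - v) * K / c" "cmod (w - v) * K / c < 1"
        using near \<open>c > 0\<close> \<open>K > 0\<close> by auto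
      have "dist (g x) (g x') \<le> cmod (w - v) * K / c * dist x x'" for x x'
      proof -
        have "c * norm (g x - g x') \<le> norm (pencil v (g x - g x'))"
          by (rule c)
        also have "pencil v (g x - g x') = (w - v) *\<^sub>C A (x - x')"
          unfolding pencil_diff g_def R by (simp add: lin scaleC.diff_right)
        also have "norm \<dots> \<le> cmod (w - v) * (K * norm (x - x'))"
          unfolding norm_scaleC by (intro mult_left_mono K) auto
        finally show ?thesis
          using \<open>c > 0\<close> by (simp add: dist_norm field_simps)
      qed
      then show "\<forall>x x'. dist (g x) (g x') \<le> cmod (w - v) * K / c * dist x x'" by blast
    qed
    then obtain x where "g x = x" by blast
    then have "pencil v x = y + (w - v) *\<^sub>C A x"
      by (metis g_def R)
    then show ?thesis
      using pencil_shift[of w x v] by (intro exI[of _ x]) simp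
  qed
  then show ?thesis
    by (metis surjI)
qed

text \<open>Half the lower bound at \<open>v\<close> remains valid nearby, so the perturbation lemma
  works from \<open>v\<close> to \<open>w\<close> and back. The uniform constant also bounds the
  resolvents near \<open>v\<close>.\<close>

lemma pencil_locally_bounded_below:
  obtains c d where "c > 0" "d > 0"
    "\<And>w x. cmod (w - v) < d \<Longrightarrow> c * norm x \<le> norm (pencil w x)"
    "\<And>w. cmod (w - v) < d \<Longrightarrow> surj (pencil v) \<longleftrightarrow> surj (pencil w)"
proof -
  obtain K where K: "K > 0" "\<And>x. norm (A x) \<le> K * norm x"
    using norm_bound by blast
  obtain b where b: "b > 0" "\<And>x. b * norm x \<le> norm (pencil v x)"
    using pencil_bounded_below by blast
  have near: "cmod (w - v) * K < b / 2" if "cmod (w - v) < b / (2 * K)" for w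
    using that K(1) by (simp add: field_simps)
  have half: "b / 2 * norm x \<le> norm (pencil w x)" if "cmod (w - v) < b / (2 * K)" for w x
  proof -
    have "norm ((w - v) *\<^sub>C A x) \<le> cmod (w - v) * (K * norm x)"
      unfolding norm_scaleC by (intro mult_left_mono K) auto
    also have "\<dots> \<le> b / 2 * norm x"
      using mult_right_mono[OF less_imp_le[OF near[OF that]], of "norm x"] by simp
    finally have "norm ((w - v) *\<^sub>C A x) \<le> b / 2 * norm x" .
    moreover have "norm (pencil v x) - norm ((w - v) *\<^sub>C A x) \<le> norm (pencil w x)"
      unfolding pencil_shift[of w x v] by (rule norm_triangle_ineq2)
    ultimately show ?thesis
      using b(2)[of x] by simp
  qed
  have "surj (pencil v) \<longleftrightarrow> surj (pencil w)" if *: "cmod (w - v) < b / (2 * K)" for w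
  proof
    show "surj (pencil w)" if "surj (pencil v)"
      using near[OF *] b(1) by (intro surj_pencil_perturb[OF K b(2) b(1) that]) simp
    show "surj (pencil v)" if "surj (pencil w)"
      using near[OF *] b(1)
      by (intro surj_pencil_perturb[OF K half[OF *] _ that]) (simp_all add: norm_minus_commute)
  qed
  then show thesis
    using that[of "b / 2" "b / (2 * K)"] half b(1) K(1) by simp
qed

text \<open>The parameters with surjective pencil form a clopen set containing \<open>0\<close>; this replaces the
  Fredholm alternative.\<close>

lemma surj_pencil: "surj (pencil w)"
proof -
  define \<Omega> where "\<Omega> = {w. surj (pencil w)}"
  have ball: "\<exists>d>0. \<forall>w\<in>ball v d. w \<in> \<Omega> \<longleftrightarrow> v \<in> \<Omega>" for v
    using pencil_locally_bounded_below[of v]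
    by (metis (mono_tags) \<Omega>_def dist_norm mem_Collect_eq mem_ball norm_minus_commute)
  have "open \<Omega>"
    unfolding open_contains_ball using ball by blast
  moreover have "open (- \<Omega>)"
    unfolding open_contains_ball using ball by blast
  moreover have "0 \<in> \<Omega>"
    by (auto simp: \<Omega>_def pencil_def scaleC.zero_left)
  ultimately have "\<Omega> = UNIV"
    using clopen[of \<Omega>] by (auto simp: closed_def)
  then show ?thesis
    by (auto simp: \<Omega>_def)
qed

section \<open>The entire resolvent and the decay of the powers\<close>

definition resolvent :: "complex \<Rightarrow> 'a \<Rightarrow> 'a" where
  "resolvent w = inv (pencil w)"

lemma pencil_resolvent [simp]: "pencil w (resolvent w y) = y"
  unfolding resolvent_def by (rule surj_f_inv_f[OF surj_pencil])

text \<open>The resolvent identity for this parametrization, checked by applying the injective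
  pencil. Both continuity and the derivative follow from it.\<close>

lemma resolvent_diff:
  "resolvent w y - resolvent v y = (w - v) *\<^sub>C resolvent w (A (resolvent v y))"
proof (rule pencil_inj)
  have "pencil w (a *\<^sub>C x) = a *\<^sub>C pencil w x" for a x
    by (simp add: pencil_def lin scaleC.diff_right scaleC_scaleC mult.commute)
  then show "pencil w (resolvent w y - resolvent v y)
      = pencil w ((w - v) *\<^sub>C resolvent w (A (resolvent v y)))"
    unfolding pencil_diff by (simp add: pencil_shift[of w "resolvent v y" v])
qed

lemma isCont_resolvent: "isCont (\<lambda>w. resolvent w y) v"
proof -
  obtain c d where c: "c > 0" "d > 0" "\<And>w x. cmod (w - v) < d \<Longrightarrow> c * norm x \<le> norm (pencil w x)"
    using pencil_locally_bounded_below by metis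
  define u where "u = A (resolvent v y)"
  have le: "norm (resolvent w y - resolvent v y) \<le> cmod (w - v) * (norm u / c)" if "cmod (w - v) < d" for w
  proof -
    have "norm (resolvent w u) \<le> norm u / c"
      using c(3)[OF that, of "resolvent w u"] c(1) by (simp add: pos_le_divide_eq mult.commute)
    then show ?thesis
      unfolding resolvent_diff norm_scaleC u_def by (rule mult_left_mono) simp
  qed
  have "((\<lambda>w. resolvent w y - resolvent v y) \<longlongrightarrow> 0) (at v)"
  proof (rule Lim_null_comparison)
    show "\<forall>\<^sub>F w in at v. norm (resolvent w y - resolvent v y) \<le> cmod (w - v) * (norm u / c)"
      unfolding eventually_at using c(2) le by (auto simp: dist_norm)
    show "((\<lambda>w. cmod (w - v) * (norm u / c)) \<longlongrightarrow> 0) (at v)"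
      by (intro tendsto_mult_left_zero tendsto_norm_zero LIM_zero tendsto_ident_at)
  qed
  then show ?thesis
    unfolding isCont_def using LIM_zero_iff by blast
qed

text \<open>Pairing with \<open>z\<close> gives scalar functions, to which Cauchy's inequality
  applies. By the resolvent identity the difference quotient is itself a pairing with a resolvent,
  whose limit is known by continuity.\<close>

lemma holomorphic_resolvent: "(\<lambda>w. cinner (resolvent w y) z) holomorphic_on S"
proof -
  have "((\<lambda>w. cinner (resolvent w y) z) has_field_derivative cinner (resolvent v (A (resolvent v y))) z) (at v)"
    for v
    unfolding has_field_derivative_iff
  proof (rule Lim_transform_eventually)
    show "((\<lambda>w. cinner (resolvent w (A (resolvent v y))) z) \<longlongrightarrow> cinner (resolvent v (A (resolvent v y))) z) (at v)"
      using isCont_resolvent[unfolded isCont_def] by (intro cinner.tendsto tendsto_const)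
    show "\<forall>\<^sub>F w in at v. cinner (resolvent w (A (resolvent v y))) z
        = (cinner (resolvent w y) z - cinner (resolvent v y) z) / (w - v)"
      unfolding cinner.diff_left[symmetric] resolvent_diff
      by (auto simp: cinner_scaleC_left eventually_at intro: exI[of _ 1])
  qed
  then show ?thesis
    by (meson DERIV_subset holomorphic_on_def field_differentiable_def has_field_derivative_at_within)
qed

lemma power_norm_le:
  assumes "K \<ge> 0" "\<And>x. norm (A x) \<le> K * norm x"
  shows "norm ((A ^^ n) x) \<le> K ^ n * norm x"
proof (induction n)
  case (Suc n)
  have "norm ((A ^^ Suc n) x) \<le> K * norm ((A ^^ n) x)"
    using assms(2) by simp
  also have "\<dots> \<le> K * (K ^ n * norm x)"
    using Suc assms(1) by (rule mult_left_mono)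
  finally show ?case by simp
qed simp

text \<open>The Neumann series with exact remainder, obtained by iterating
  \<open>resolvent w y = y + w *\<^sub>C A (resolvent w y)\<close>; it holds for all
  \<open>w\<close>.\<close>

lemma resolvent_expansion:
  "resolvent w y = (\<Sum>k<n. w ^ k *\<^sub>C (A ^^ k) y) + w ^ n *\<^sub>C (A ^^ n) (resolvent w y)"
proof (induction n)
  case (Suc n)
  have *: "(A ^^ n) (x + a *\<^sub>C z) = (A ^^ n) x + a *\<^sub>C (A ^^ n) z" for x z a
    by (induction n) (simp_all add: lin)
  have "resolvent w y = y + w *\<^sub>C A (resolvent w y)"
    using pencil_resolvent[of w y] unfolding pencil_def by (metis diff_add_cancel)
  then have "(A ^^ n) (resolvent w y) = (A ^^ n) y + w *\<^sub>C (A ^^ Suc n) (resolvent w y)"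
    by (metis * funpow_swap1 funpow.simps(2) comp_apply)
  then have step: "w ^ n *\<^sub>C (A ^^ n) (resolvent w y)
      = w ^ n *\<^sub>C (A ^^ n) y + w ^ Suc n *\<^sub>C (A ^^ Suc n) (resolvent w y)"
    by (simp only: scaleC_add_right scaleC_scaleC power_Suc2)
  have "resolvent w y = (\<Sum>k<n. w ^ k *\<^sub>C (A ^^ k) y) + w ^ n *\<^sub>C (A ^^ n) (resolvent w y)"
    by (rule Suc)
  also have "\<dots> = (\<Sum>k<Suc n. w ^ k *\<^sub>C (A ^^ k) y) + w ^ Suc n *\<^sub>C (A ^^ Suc n) (resolvent w y)"
    unfolding step sum.lessThan_Suc by (rule add.assoc[symmetric])
  finally show ?case .
qed simp

text \<open>For \<open>cmod w < 1 / K\<close> the remainder of the expansion tends to 0, so the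
  pairings of the powers are Taylor coefficients of an entire function.\<close>

lemma power_coefficient:
  "cinner ((A ^^ n) y) z = (deriv ^^ n) (\<lambda>w. cinner (resolvent w y) z) 0 / fact n"
proof -
  obtain K where K: "K > 0" "\<And>x. norm (A x) \<le> K * norm x"
    using norm_bound by blast
  have "(\<lambda>n. cinner ((A ^^ n) y) z * w ^ n) sums cinner (resolvent w y) z" if w: "cmod w < 1 / K" for w
  proof -
    have "(\<lambda>n. w ^ n *\<^sub>C (A ^^ n) (resolvent w y)) \<longlonglongrightarrow> 0"
    proof (rule Lim_null_comparison)
      show "\<forall>\<^sub>F n in sequentially. norm (w ^ n *\<^sub>C (A ^^ n) (resolvent w y))
          \<le> (cmod w * K) ^ n * norm (resolvent w y)"
      proof (intro always_eventually allI)
        fix n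
        show "norm (w ^ n *\<^sub>C (A ^^ n) (resolvent w y)) \<le> (cmod w * K) ^ n * norm (resolvent w y)"
          using mult_left_mono[OF power_norm_le[OF less_imp_le[OF K(1)] K(2), of n "resolvent w y"], of "cmod w ^ n"]
          by (simp add: norm_scaleC norm_power power_mult_distrib mult.assoc)
      qed
      show "(\<lambda>n. (cmod w * K) ^ n * norm (resolvent w y)) \<longlonglongrightarrow> 0"
        using w K(1) by (intro tendsto_mult_left_zero LIMSEQ_realpow_zero) (auto simp: field_simps)
    qed
    then have "(\<lambda>n. resolvent w y - w ^ n *\<^sub>C (A ^^ n) (resolvent w y)) \<longlonglongrightarrow> resolvent w y - 0"
      by (intro tendsto_diff tendsto_const)
    moreover have "resolvent w y - w ^ n *\<^sub>C (A ^^ n) (resolvent w y) = (\<Sum>k<n. w ^ k *\<^sub>C (A ^^ k) y)" for n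
      using resolvent_expansion[of w y n] by (metis add_diff_cancel_right')
    ultimately have "(\<lambda>k. w ^ k *\<^sub>C (A ^^ k) y) sums resolvent w y"
      by (simp add: sums_def)
    from bounded_linear.sums[OF cinner.bounded_linear_left this, of z] show ?thesis
      by (simp add: cinner_scaleC_left mult.commute)
  qed
  moreover have "\<forall>\<^sub>F w in nhds 0. cmod w < 1 / K"
    using eventually_nhds_ball[of "1 / K" "0::complex"] K(1) by simp
  ultimately have "(\<lambda>w. cinner (resolvent w y) z) has_fps_expansion Abs_fps (\<lambda>n. cinner ((A ^^ n) y) z)"
    by (intro has_fps_expansionI) (auto elim: eventually_mono)
  from fps_nth_fps_expansion[OF this] show ?thesis by simp
qed

text \<open>The resolvent is entire, so Cauchy's inequality for its Taylor coefficients can be used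
  on a circle of any radius \<open>r\<close>.\<close>

theorem power_decay:
  assumes "r > 0"
  obtains C where "\<And>n. norm ((A ^^ n) y) * r ^ n \<le> C"
proof -
  have "compact ((\<lambda>w. resolvent w y) ` sphere 0 r)"
    using isCont_resolvent by (intro compact_continuous_image continuous_at_imp_continuous_on) auto
  then obtain C where C: "\<And>w. w \<in> sphere 0 r \<Longrightarrow> norm (resolvent w y) \<le> C"
    using compact_imp_bounded bounded_pos by (metis image_eqI)
  have "norm ((A ^^ n) y) * r ^ n \<le> C" for n
  proof (cases "(A ^^ n) y = 0")
    case True
    have "complex_of_real r \<in> sphere 0 r" using assms by simp
    then have "0 \<le> C" using C norm_ge_zero order_trans by blast
    then show ?thesis using True by simp
  next
    case False
    \<comment> \<open>Testing against the power itself turns the weak estimate into a norm estimate;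
      \<open>C\<close> does not depend on this choice.\<close>
    define z where "z = (A ^^ n) y"
    have "norm ((deriv ^^ n) (\<lambda>w. cinner (resolvent w y) z) 0) \<le> fact n * (C * norm z) / r ^ n"
    proof (rule Cauchy_inequality)
      show "continuous_on (cball 0 r) (\<lambda>w. cinner (resolvent w y) z)"
        by (intro holomorphic_on_imp_continuous_on holomorphic_resolvent)
      show "cmod (cinner (resolvent w y) z) \<le> C * norm z" if "norm (0 - w) = r" for w
      proof -
        have "norm (resolvent w y) * norm z \<le> C * norm z"
          using that by (intro mult_right_mono C) auto
        then show ?thesis
          using norm_cinner_le[of "resolvent w y" z] by linarith
      qed
    qed (use assms holomorphic_resolvent in auto)
    then have "cmod (cinner ((A ^^ n) y) z) \<le> C * norm z / r ^ n"
      unfolding power_coefficient by (simp add: norm_divide field_simps)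
    then have "norm z * norm z * r ^ n \<le> C * norm z"
      using assms unfolding z_def cinner_self norm_of_real by (simp add: field_simps power2_eq_square)
    then show ?thesis
      using False unfolding z_def by (simp add: mult.assoc mult.commute[of C])
  qed
  then show thesis using that by blast
qed

end

section \<open>Lomonosov's theorem\<close>

definition commutant :: "('a::complex_inner \<Rightarrow> 'a) \<Rightarrow> ('a \<Rightarrow> 'a) set" where
  "commutant A = {S. bounded_clinear S \<and> (\<forall>x. S (A x) = A (S x))}"

lemma ident_in_commutant: "(\<lambda>x. x) \<in> commutant A"
  by (simp add: commutant_def bounded_clinear_ident)

lemma commutant_compose: "S \<in> commutant A \<Longrightarrow> R \<in> commutant A \<Longrightarrow> (\<lambda>x. S (R x)) \<in> commutant A"
  by (simp add: commutant_def bounded_clinear_compose)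

text \<open>These closures are the candidate invariant subspaces. For nonzero \<open>y\<close> such
  a closure contains \<open>y\<close>, so if no invariant subspace is proper and nonzero, the orbit
  is dense.\<close>

lemma closed_csubspace_commutant_orbit:
  assumes "bounded_clinear A"
  shows "closed_csubspace (closure {S y | S. S \<in> commutant A})"
proof (rule closed_csubspace_closure, unfold complex_vector.subspace_def, intro conjI ballI allI)
  note lin = bounded_clinearD[OF assms]
  have "(\<lambda>x. 0) \<in> commutant A"
    using bounded_clinear_scaleC[OF bounded_clinear_ident, of 0]
    by (simp add: commutant_def lin scaleC.zero_left)
  then show "0 \<in> {S y | S. S \<in> commutant A}"
    by force
next
  note lin = bounded_clinearD[OF assms]
  fix u v assume "u \<in> {S y | S. S \<in> commutant A}" "v \<in> {S y | S. S \<in> commutant A}"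
  then obtain S R where "S \<in> commutant A" "R \<in> commutant A" "u = S y" "v = R y" by blast
  moreover from this have "(\<lambda>x. S x + R x) \<in> commutant A"
    by (simp add: commutant_def lin bounded_clinear_add)
  ultimately show "u + v \<in> {S y | S. S \<in> commutant A}"
    by (auto intro!: exI[of _ "\<lambda>x. S x + R x"])
next
  note lin = bounded_clinearD[OF assms]
  fix a u assume "u \<in> {S y | S. S \<in> commutant A}"
  then obtain S where "S \<in> commutant A" "u = S y" by blast
  moreover from this have "(\<lambda>x. a *\<^sub>C S x) \<in> commutant A"
    by (simp add: commutant_def lin bounded_clinear_scaleC)
  ultimately show "a *\<^sub>C u \<in> {S y | S. S \<in> commutant A}"
    by (auto intro!: exI[of _ "\<lambda>x. a *\<^sub>C S x"])
qed

lemma commutant_orbit_invariant: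
  assumes "S \<in> commutant A"
  shows "S ` closure {R y | R. R \<in> commutant A} \<subseteq> closure {R y | R. R \<in> commutant A}"
proof (rule image_closure_subset)
  show "continuous_on (closure {R y | R. R \<in> commutant A}) S"
    using assms by (intro linear_continuous_on bounded_clinearD) (simp add: commutant_def)
  have "S ` {R y | R. R \<in> commutant A} \<subseteq> {R y | R. R \<in> commutant A}"
    by (auto dest: commutant_compose[OF assms])
  then show "S ` {R y | R. R \<in> commutant A} \<subseteq> closure {R y | R. R \<in> commutant A}"
    using closure_subset by blast
qed simp

lemma finite_commutant_bound:
  assumes "finite C" "C \<subseteq> commutant A"
  obtains c where "c > 0" "\<And>S x. S \<in> C \<Longrightarrow> norm (S x) \<le> c * norm x"
proof -
  have "\<forall>S\<in>C. \<exists>K>0. \<forall>x. norm (S x) \<le> K * norm x"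
    using assms(2) bounded_clinearD(1) bounded_linear.pos_bounded
    by (metis (no_types, lifting) commutant_def mem_Collect_eq mult.commute subsetD)
  then obtain K where K: "\<And>S. S \<in> C \<Longrightarrow> K S > 0" "\<And>S x. S \<in> C \<Longrightarrow> norm (S x) \<le> K S * norm x"
    by metis
  \<comment> \<open>The summand 1 keeps the bound positive when \<open>C\<close> is empty.\<close>
  have "norm (S x) \<le> (1 + sum K C) * norm x" if "S \<in> C" for S x
  proof -
    have "K S \<le> 1 + sum K C"
      using member_le_sum[OF that, of K] K(1) assms(1) by (fastforce intro: less_imp_le)
    then show ?thesis
      using K(2)[OF that, of x] by (meson mult_right_mono norm_ge_zero order_trans)
  qed
  moreover have "1 + sum K C > 0"
    using sum_nonneg[of C K] K(1) by (force intro: add_pos_nonneg less_imp_le)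
  ultimately show thesis using that by blast
qed

text \<open>Hilden's argument: if every orbit of the commutant were dense, finitely many commuting
  operators would suffice to return \<open>A u\<close> to a ball for all \<open>u\<close> in that ball. Iterating, \<open>(A ^^ n) x0\<close>
  for the centre \<open>x0\<close> could decay at most geometrically, contradicting \<open>power_decay\<close>.\<close>

theorem (in compact_operator_no_eigenvalue) lomonosov_no_eigenvalue:
  assumes "A x0 \<noteq> 0"
  shows "\<exists>M. closed_csubspace M \<and> M \<noteq> {0} \<and> M \<noteq> UNIV \<and> (\<forall>S\<in>commutant A. S ` M \<subseteq> M)"
proof (rule ccontr)
  assume no: "\<not> ?thesis"
  have dense: "closure {S y | S. S \<in> commutant A} = UNIV" if "y \<noteq> 0" for y
  proof -
    have "y \<in> closure {S y | S. S \<in> commutant A}"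
      using ident_in_commutant closure_subset by fastforce
    then have "closure {S y | S. S \<in> commutant A} \<noteq> {0}"
      using that by blast
    then show ?thesis
      using no closed_csubspace_commutant_orbit[OF clinear] commutant_orbit_invariant by blast
  qed
  obtain K where K: "K > 0" "\<And>x. norm (A x) \<le> K * norm x"
    using norm_bound by blast
  \<comment> \<open>The radius \<open>\<delta> / K\<close> of \<open>U\<close> keeps
    \<open>A u\<close> within \<open>\<delta>\<close> of \<open>A x0\<close>. Hence \<open>Q\<close>
    avoids 0, and every point of \<open>Q\<close> has a dense orbit.\<close>
  define \<delta> where "\<delta> = norm (A x0) / 2"
  define U where "U = ball x0 (\<delta> / K)"
  have \<delta>: "\<delta> > 0" using assms by (simp add: \<delta>_def)
  have far: "\<delta> \<le> norm (A u)" if "u \<in> U" for u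
  proof -
    have "norm (A (x0 - u)) \<le> K * (\<delta> / K)"
      using that K(1) unfolding U_def
      by (intro order_trans[OF K(2)] mult_left_mono) (auto simp: dist_norm)
    then have "norm (A x0 - A u) \<le> \<delta>"
      using K(1) by (simp add: lin)
    then show ?thesis
      using norm_triangle_ineq2[of "A x0" "A u"] by (simp add: \<delta>_def)
  qed
  define Q where "Q = closure (A ` U)"
  have "U \<subseteq> cball 0 (norm x0 + \<delta> / K)"
  proof
    fix u assume "u \<in> U"
    then show "u \<in> cball 0 (norm x0 + \<delta> / K)"
      using norm_triangle_sub[of u x0] by (simp add: U_def dist_norm norm_minus_commute)
  qed
  then have "Q = Q \<inter> closure (A ` cball 0 (norm x0 + \<delta> / K))"
    unfolding Q_def using closure_mono[OF image_mono] by blast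
  then have "compact Q"
    using compact_image closed_Int_compact[of Q] unfolding Q_def by (metis closed_closure)
  have "Q \<subseteq> {y. \<delta> \<le> norm y}"
    unfolding Q_def using far by (intro closure_minimal closed_Collect_le continuous_intros) auto
  then have Q_nz: "0 \<notin> Q" using \<delta> by auto
  have "\<exists>S\<in>commutant A. S y \<in> U" if "y \<in> Q" for y
  proof -
    have "x0 \<in> closure {S y | S. S \<in> commutant A}"
      using dense[of y] that Q_nz by auto
    moreover have "\<delta> / K > 0" using \<delta> K(1) by simp
    ultimately show ?thesis
      unfolding closure_approachable U_def by (force simp: dist_commute)
  qed
  then have "Q \<subseteq> (\<Union>S\<in>commutant A. S -` U)" by blast
  moreover have "open (S -` U)" if "S \<in> commutant A" for S
    using that unfolding commutant_def U_def
    by (intro open_vimage linear_continuous_on bounded_clinearD) auto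
  ultimately obtain C where C: "C \<subseteq> commutant A" "finite C" "Q \<subseteq> (\<Union>S\<in>C. S -` U)"
    using compactE_image[OF \<open>compact Q\<close>, of "commutant A" "\<lambda>S. S -` U"] by blast
  obtain c where c: "c > 0" "\<And>S x. S \<in> C \<Longrightarrow> norm (S x) \<le> c * norm x"
    using finite_commutant_bound[OF C(2,1)] by blast
  \<comment> \<open>\<open>W\<close> is composed of \<open>n\<close> operators from
    \<open>C\<close>, which explains \<open>c ^ n\<close>. Since \<open>W\<close> commutes with
    \<open>A\<close>, each new factor \<open>A\<close> can be moved next to
    \<open>x0\<close>.\<close>
  have orbit: "\<exists>W\<in>commutant A. W ((A ^^ n) x0) \<in> U \<and> (\<forall>x. norm (W x) \<le> c ^ n * norm x)" for n
  proof (induction n)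
    case 0
    have "x0 \<in> U" using \<delta> K(1) by (simp add: U_def)
    then show ?case
      using ident_in_commutant by (intro bexI[of _ "\<lambda>x. x"]) auto
  next
    case (Suc n)
    then obtain W where W: "W \<in> commutant A" "W ((A ^^ n) x0) \<in> U" "\<And>x. norm (W x) \<le> c ^ n * norm x"
      by blast
    then have "A (W ((A ^^ n) x0)) \<in> Q"
      unfolding Q_def using closure_subset by blast
    then obtain S where S: "S \<in> C" "S (A (W ((A ^^ n) x0))) \<in> U"
      using C(3) by blast
    have "norm (S (W x)) \<le> c ^ Suc n * norm x" for x
    proof -
      have "norm (S (W x)) \<le> c * norm (W x)"
        by (rule c) (rule S)
      also have "\<dots> \<le> c * (c ^ n * norm x)"
        using c(1) by (intro mult_left_mono W) auto
      finally show ?thesis by (simp add: mult.assoc)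
    qed
    moreover have "S (W ((A ^^ Suc n) x0)) \<in> U"
      using S(2) W(1) by (simp add: commutant_def)
    ultimately show ?case
      using commutant_compose[of S A W] S(1) C(1) W(1)
      by (intro bexI[of _ "\<lambda>x. S (W x)"]) auto
  qed
  \<comment> \<open>Decay at rate \<open>2 * c\<close> beats the growth \<open>c ^ n\<close> of
    \<open>W\<close> by a factor \<open>(1 / 2) ^ n\<close>.\<close>
  obtain B where B: "\<And>n. norm ((A ^^ n) x0) * (2 * c) ^ n \<le> B"
    using power_decay[of "2 * c" x0] c(1) by (metis mult_pos_pos zero_less_numeral)
  have "\<delta> / K \<le> B * (1 / 2) ^ n" for n
  proof -
    obtain W where W: "W ((A ^^ n) x0) \<in> U" "norm (W ((A ^^ n) x0)) \<le> c ^ n * norm ((A ^^ n) x0)"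
      using orbit by blast
    \<comment> \<open>Points of \<open>U\<close> stay away from 0, because their images have norm at
      least \<open>\<delta>\<close> and \<open>A\<close> has bound \<open>K\<close>.\<close>
    have "\<delta> / K \<le> norm (W ((A ^^ n) x0))"
      using far[OF W(1)] K(2)[of "W ((A ^^ n) x0)"] K(1) by (simp add: field_simps)
    also have "\<dots> \<le> norm ((A ^^ n) x0) * (2 * c) ^ n * (1 / 2) ^ n"
      using W(2) by (simp add: power_mult_distrib power_divide mult.commute)
    also have "\<dots> \<le> B * (1 / 2) ^ n"
      by (intro mult_right_mono B) simp
    finally show ?thesis .
  qed
  moreover have "(\<lambda>n. B * (1 / 2) ^ n) \<longlonglongrightarrow> 0"
    by (intro tendsto_mult_right_zero LIMSEQ_realpow_zero) auto
  ultimately have "\<delta> / K \<le> 0"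
    by (intro LIMSEQ_le_const) auto
  then show False
    using \<delta> K(1) by (simp add: divide_le_0_iff)
qed

text \<open>\<open>nonscalar\<close> serves both cases: it makes an eigenspace proper, and for
  \<open>l = 0\<close> it supplies a centre \<open>x0\<close> with nonzero image.\<close>

theorem (in compact_operator) lomonosov:
  assumes nonscalar: "\<And>l. \<not> (\<forall>x. A x = l *\<^sub>C x)"
  shows "\<exists>M. closed_csubspace M \<and> M \<noteq> {0} \<and> M \<noteq> UNIV \<and> (\<forall>S\<in>commutant A. S ` M \<subseteq> M)"
proof (cases "\<exists>l v. l \<noteq> 0 \<and> v \<noteq> 0 \<and> A v = l *\<^sub>C v")
  case True
  then obtain l v where v: "v \<noteq> 0" "A v = l *\<^sub>C v" by blast
  define E where "E = {x. A x = l *\<^sub>C x}"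
  have "closed E"
    unfolding E_def by (intro closed_Collect_eq linear_continuous_on lin scaleC.bounded_linear_right)
  then have "closed_csubspace E"
    by (auto simp: closed_csubspace_def complex_vector.subspace_def E_def lin scaleC_add_right
        scaleC_scaleC scaleC.zero_right mult.commute)
  moreover have "S ` E \<subseteq> E" if "S \<in> commutant A" for S
  proof safe
    fix x assume "x \<in> E"
    then have "S (A x) = S (l *\<^sub>C x)" by (simp add: E_def)
    then show "S x \<in> E"
      using that by (simp add: commutant_def E_def bounded_clinearD)
  qed
  moreover have "E \<noteq> {0}" "E \<noteq> UNIV"
    using v nonscalar by (auto simp: E_def)
  ultimately show ?thesis by blast
next
  case False
  interpret compact_operator_no_eigenvalue A
    by unfold_locales (use False in blast)
  have "\<exists>x0. A x0 \<noteq> 0"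
    using nonscalar[of 0] by (auto simp: scaleC.zero_left)
  then show ?thesis
    using lomonosov_no_eigenvalue by blast
qed

section \<open>Passage between the operator and its bounded inverse\<close>

lemma inv_into_UNIV:
  assumes "bij_betw T D UNIV"
  shows "inv_into D T y \<in> D" "T (inv_into D T y) = y" "x \<in> D \<Longrightarrow> inv_into D T (T x) = x"
  using assms inv_into_into[of y T D] f_inv_into_f[of y T D] by (auto simp: bij_betw_def)

text \<open>Under \<open>x = A z\<close> the quotient of \<open>norm (T x)\<close> by
  \<open>norm x\<close> becomes the reciprocal of that of \<open>norm (A z)\<close> by
  \<open>norm z\<close>, so a minimizer \<open>x0\<close> for \<open>T\<close> gives the maximizer
  \<open>T x0\<close> for its inverse.\<close>

lemma attaining_operator_inverse:
  fixes D :: "'a::chilbert_space set"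
  assumes "operator_on D T" "absolutely_minimum_attaining D T" "unbounded_operator D T"
    and "has_bounded_inverse D T"
  shows "attaining_operator (inv_into D T)"
proof
  define A where "A = inv_into D T"
  have bij: "bij_betw T D UNIV" and clin: "bounded_clinear A"
    using assms(4) by (auto simp: has_bounded_inverse_def A_def)
  then show "bounded_clinear (inv_into D T)"
    by (simp add: A_def)
  note lin = bounded_clinearD[OF clin]
  note AD = inv_into_UNIV(1)[OF bij, folded A_def] and TA = inv_into_UNIV(2)[OF bij, folded A_def]
    and AT = inv_into_UNIV(3)[OF bij, folded A_def]
  have T0: "T 0 = 0"
    using TA[of 0] by (simp add: lin)
  show inj: "x = 0" if "inv_into D T x = 0" for x
    using that TA[of x] T0 by (simp add: A_def)
  have T_scale: "T (a *\<^sub>C x) = a *\<^sub>C T x" if "x \<in> D" for a x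
    using assms(1) that by (simp add: operator_on_def)
  show "\<not> (\<exists>c>0. \<forall>y. c * norm y \<le> norm (inv_into D T y))"
  proof
    assume "\<exists>c>0. \<forall>y. c * norm y \<le> norm (inv_into D T y)"
    then obtain c where c: "c > 0" "\<And>y. c * norm y \<le> norm (A y)"
      by (auto simp: A_def)
    have "norm (T x) \<le> (1 / c) * norm x" if "x \<in> D" for x
      using c(2)[of "T x"] c(1) that by (simp add: AT field_simps)
    then show False
      using assms(3) unfolding unbounded_operator_def by blast
  qed
  fix M y
  assume M: "closed_csubspace M" and y: "inv_into D T y \<in> M" "y \<noteq> 0"
  then have "A y \<in> D \<inter> M" "A y \<noteq> 0"
    using AD inj by (auto simp: A_def)
  then have "D \<inter> M \<noteq> {0}" by blast
  then obtain x0 where x0: "x0 \<in> D" "x0 \<in> M" "norm x0 = 1" "norm (T x0) = min_modulus_on D T M"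
    using assms(2) M unfolding absolutely_minimum_attaining_def by blast
  have "norm (A z) * norm (T x0) \<le> norm (A (T x0)) * norm z" if "A z \<in> M" for z
  proof (cases "A z = 0")
    case False
    \<comment> \<open>Normalizing \<open>A z\<close> makes it a competitor in the infimum that
      defines \<open>min_modulus_on\<close>.\<close>
    define a where "a = complex_of_real (inverse (norm (A z)))"
    have a: "cmod a = inverse (norm (A z))"
      by (simp add: a_def norm_inverse)
    have "a *\<^sub>C A z \<in> D \<inter> M" "norm (a *\<^sub>C A z) = 1"
      using AD[of "a *\<^sub>C z"] that M False
      by (auto simp: lin closed_csubspace_def complex_vector.subspace_scale norm_scaleC a)
    then have "min_modulus_on D T M \<le> norm (T (a *\<^sub>C A z))"
      unfolding min_modulus_on_def by (intro cInf_lower bdd_belowI[of _ 0]) auto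
    also have "\<dots> = norm z / norm (A z)"
      by (simp add: T_scale[OF AD] TA norm_scaleC a field_simps)
    finally show ?thesis
      using False by (simp add: x0 AT field_simps)
  qed simp
  moreover have "T x0 \<noteq> 0"
    using x0(1,3) AT[of x0] by (auto simp: lin)
  ultimately show "\<exists>y0. y0 \<noteq> 0 \<and> inv_into D T y0 \<in> M \<and>
      (\<forall>z. inv_into D T z \<in> M \<longrightarrow> norm (inv_into D T z) * norm y0 \<le> norm (inv_into D T y0) * norm z)"
    using x0 AT[of x0] by (intro exI[of _ "T x0"]) (auto simp: A_def)
qed

theorem theorem4p13:
  fixes D :: "'a::chilbert_space set" and T :: "'a \<Rightarrow> 'a"
  assumes infinite_dim: "\<not> (\<exists>B :: 'a set. finite B \<and> complex_vector.span B = UNIV)"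
    and "densely_defined D"
    and "closed_operator D T"
    and "absolutely_minimum_attaining D T"
    and "unbounded_operator D T"
    and "has_bounded_inverse D T"
  shows "\<exists>M. hyperinvariant D T M \<and> M \<noteq> {0} \<and> M \<noteq> UNIV"
proof -
  define A where "A = inv_into D T"
  interpret attaining_operator A
    unfolding A_def using assms(3-6)
    by (intro attaining_operator_inverse) (auto simp: closed_operator_def)
  interpret compact_operator A
    by unfold_locales (rule clinear compact_image_cball)+
  have bij: "bij_betw T D UNIV"
    using assms(6) by (simp add: has_bounded_inverse_def)
  note AD = inv_into_UNIV(1)[OF bij, folded A_def] and TA = inv_into_UNIV(2)[OF bij, folded A_def]
    and AT = inv_into_UNIV(3)[OF bij, folded A_def]
  \<comment> \<open>If \<open>A\<close> were 0, injectivity would force \<open>T\<close> to vanish;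
    a nonzero multiple of the identity is bounded below. Both contradict unboundedness of
    \<open>T\<close>.\<close>
  have nonscalar: "\<not> (\<forall>x. A x = l *\<^sub>C x)" for l
  proof
    assume *: "\<forall>x. A x = l *\<^sub>C x"
    show False
    proof (cases "l = 0")
      case True
      have "T x = 0" for x
        using * True injective[of "T x"] by (simp add: scaleC.zero_left)
      then have "\<forall>x\<in>D. norm (T x) \<le> 0 * norm x" by simp
      then show False
        using assms(5) unfolding unbounded_operator_def by blast
    next
      case False
      then show False
        using not_bounded_below * by (metis norm_scaleC order_refl zero_less_norm_iff)
    qed
  qed
  obtain M where M: "closed_csubspace M \<and> M \<noteq> {0} \<and> M \<noteq> UNIV \<and> (\<forall>S\<in>commutant A. S ` M \<subseteq> M)"
    using lomonosov[OF nonscalar] ..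
  \<comment> \<open>Evaluating the inclusion at \<open>A y\<close> and inverting \<open>T\<close>
    turns commutation with \<open>T\<close> into commutation with \<open>A\<close>.\<close>
  have "S \<in> commutant A" if "bounded_clinear S" "commutes_with S D T" for S
  proof -
    have "S (A y) = A (S y)" for y
      using that(2) AD[of y] TA[of y] AT unfolding commutes_with_def by metis
    then show ?thesis
      using that(1) by (simp add: commutant_def)
  qed
  then have "hyperinvariant D T M"
    using M by (simp add: hyperinvariant_def)
  then show ?thesis
    using M by (intro exI[of _ M]) simp
qed

end
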